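(* For $r\le m+n-1$, $$\mathcal{H}\bigl(\mathcal{D}^{(m)}(\mathcal{A}_{n,r})\bigr)(b)=[a^m]\,\frac{(1-a+ab)^r}{(1-a)^n(1-b)^n},$$ where $m,n,r$ are positive integers and $\mathcal{A}_{n,r}$ is any generic arrangement of $r$ hyperplanes in $\mathbb{C}^n$.
   Context: For a positive integer $n$, let $S=\mathbb{C}[x_1,\dots,x_n]$. A (central) $n$-arrangement $\mathcal{A}$ of $r$ hyperplanes is a set of $r$ distinct hyperplanes through the origin in $\mathbb{C}^n$, with defining polynomial $p=p_1\cdots p_r\in S$, where the $p_i$ are nonzero linear forms defining the hyperplanes. It is generic if every intersection of $s\le n$ of its hyperplanes has codimension $s$. Write $\partial^\alpha=\partial_1^{\alpha_1}\cdots\partial_n^{\alpha_n}$ and $|\alpha|=\alpha_1+\dots+\alpha_n$ for $\alpha\in\mathbb{N}^n$, and let $\delta*v$ denote the action of a differential operator $\delta$ with polynomial coefficients on $v\in S$. Define $$\mathcal{D}^{(m)}(\mathcal{A})=\Bigl\{\delta=\sum_{|\alpha|=m}c_\alpha\partial^\alpha : c_\alpha\in S,\ \delta*\langle p\rangle\subseteq\langle p\rangle\Bigr\},$$ where $\langle p\rangle$ is the principal ideal of $S$ generated by $p$. This is a finitely generated graded $S$-module, graded by polynomial degree: $\sum c_\alpha\partial^\alpha$ is homogeneous of degree $v$ if all nonzero $c_\alpha$ are homogeneous of degree $v$. Its Hilbert series is $\mathcal{H}(\mathcal{D}^{(m)}(\mathcal{A}))(b)=\sum_{v\ge 0}\dim_{\mathbb{C}}\bigl(\mathcal{D}^{(m)}(\mathcal{A})\bigr)_v\,b^v$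 (equivalently, $(1-b)^{-n}$ times the Poincaré–Betti series $\sum_{j,i}\beta_{j,i}b^it^j$ of the minimal graded free resolution over $S$, evaluated at $t=-1$). For a formal power series $f$ in $a$, $[a^m]f$ denotes the coefficient of $a^m$. *)

theory Defs
  imports
    Complex_Main
    "HOL-Library.Poly_Mapping"
    "HOL-Computational_Algebra.Formal_Power_Series"
begin

text \<open>
  The number \<open>n\<close> of variables is an ordinary natural number. Polynomials live in the monoid
  algebra over finitely supported exponent vectors \<open>nat \<Rightarrow>\<^sub>0 nat\<close>, i.e. in a polynomial ring in
  countably many variables, and \<open>S = \<complex>[x\<^sub>1, \<dots>, x\<^sub>n]\<close> is the subring of those polynomials that
  involve only the variables with indices \<open>0, \<dots>, n - 1\<close>. Likewise \<open>\<complex>\<^sup>n\<close> is the space of finitely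
  supported vectors whose support is contained in \<open>{..<n}\<close>.
\<close>

type_synonym expo = "nat \<Rightarrow>\<^sub>0 nat"
type_synonym cpoly = "expo \<Rightarrow>\<^sub>0 complex"
type_synonym point = "nat \<Rightarrow>\<^sub>0 complex"

definition expos :: "nat \<Rightarrow> expo set" where
  "expos n = {\<alpha>. Poly_Mapping.keys \<alpha> \<subseteq> {..<n}}"

definition expo_deg :: "expo \<Rightarrow> nat" where
  "expo_deg \<alpha> = (\<Sum>i\<in>Poly_Mapping.keys \<alpha>. Poly_Mapping.lookup \<alpha> i)"

definition polys :: "nat \<Rightarrow> cpoly set" where
  "polys n = {p. Poly_Mapping.keys p \<subseteq> expos n}"

definition points :: "nat \<Rightarrow> point set" where
  "points n = {v. Poly_Mapping.keys v \<subseteq> {..<n}}"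

definition homogeneous :: "nat \<Rightarrow> cpoly \<Rightarrow> bool" where
  "homogeneous d p \<longleftrightarrow> (\<forall>\<alpha>\<in>Poly_Mapping.keys p. expo_deg \<alpha> = d)"

definition poly_eval :: "cpoly \<Rightarrow> point \<Rightarrow> complex" where
  "poly_eval p v =
     (\<Sum>\<alpha>\<in>Poly_Mapping.keys p. Poly_Mapping.lookup p \<alpha> *
        (\<Prod>i\<in>Poly_Mapping.keys \<alpha>. Poly_Mapping.lookup v i ^ Poly_Mapping.lookup \<alpha> i))"

definition principal_ideal :: "nat \<Rightarrow> cpoly \<Rightarrow> cpoly set" where
  "principal_ideal n p = {q * p | q. q \<in> polys n}"


text \<open>
  On monomials, \<open>\<partial>\<^sub>i x\<^sup>\<beta> = \<beta>\<^sub>i x\<^bsup>\<beta> - e\<^sub>i\<^esup>\<close>. The truncated subtraction is harmless, since the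
  coefficient vanishes when \<open>\<beta>\<^sub>i = 0\<close>.
\<close>

definition partial_deriv :: "nat \<Rightarrow> cpoly \<Rightarrow> cpoly" where
  "partial_deriv i p =
     (\<Sum>\<beta>\<in>Poly_Mapping.keys p.
        Poly_Mapping.single (\<beta> - Poly_Mapping.single i 1)
          (of_nat (Poly_Mapping.lookup \<beta> i) * Poly_Mapping.lookup p \<beta>))"

definition iter_deriv :: "nat \<Rightarrow> expo \<Rightarrow> cpoly \<Rightarrow> cpoly" where
  "iter_deriv n \<alpha> f =
     foldr (\<lambda>i. partial_deriv i ^^ Poly_Mapping.lookup \<alpha> i) [0..<n] f"

text \<open>
  An operator \<open>\<Sum> c\<^sub>\<alpha> \<partial>\<^sup>\<alpha>\<close> is its finitely supported coefficient family \<open>\<alpha> \<mapsto> c\<^sub>\<alpha>\<close>; these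
  coefficients are uniquely determined by the operator. The multiplication that the type
  \<open>diffop\<close> inherits from \<open>poly_mapping\<close> is not composition and is not used.
\<close>

type_synonym diffop = "expo \<Rightarrow>\<^sub>0 cpoly"

definition diffop_apply :: "nat \<Rightarrow> diffop \<Rightarrow> cpoly \<Rightarrow> cpoly" where
  "diffop_apply n \<delta> f =
     (\<Sum>\<alpha>\<in>Poly_Mapping.keys \<delta>. Poly_Mapping.lookup \<delta> \<alpha> * iter_deriv n \<alpha> f)"

definition diffops :: "nat \<Rightarrow> nat \<Rightarrow> diffop set" where
  "diffops n m =
     {\<delta>. Poly_Mapping.keys \<delta> \<subseteq> {\<alpha> \<in> expos n. expo_deg \<alpha> = m} \<and>
         (\<forall>\<alpha>. Poly_Mapping.lookup \<delta> \<alpha> \<in> polys n)}"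

definition arr_diffops :: "nat \<Rightarrow> nat \<Rightarrow> cpoly \<Rightarrow> diffop set" where
  "arr_diffops n m p =
     {\<delta> \<in> diffops n m. diffop_apply n \<delta> ` principal_ideal n p \<subseteq> principal_ideal n p}"

definition diffop_homogeneous :: "nat \<Rightarrow> diffop \<Rightarrow> bool" where
  "diffop_homogeneous v \<delta> \<longleftrightarrow>
     (\<forall>\<alpha>\<in>Poly_Mapping.keys \<delta>. homogeneous v (Poly_Mapping.lookup \<delta> \<alpha>))"


definition point_scale :: "complex \<Rightarrow> point \<Rightarrow> point" where
  "point_scale c = Poly_Mapping.map (\<lambda>z. c * z)"

definition diffop_scale :: "complex \<Rightarrow> diffop \<Rightarrow> diffop" where
  "diffop_scale c = Poly_Mapping.map (\<lambda>q. Poly_Mapping.single 0 c * q)"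

lemma lookup_point_scale:
  "Poly_Mapping.lookup (point_scale c v) i = c * Poly_Mapping.lookup v i"
  by (simp add: point_scale_def Poly_Mapping.map.rep_eq when_def)

lemma lookup_diffop_scale:
  "Poly_Mapping.lookup (diffop_scale c \<delta>) \<alpha> =
     Poly_Mapping.single 0 c * Poly_Mapping.lookup \<delta> \<alpha>"
  by (simp add: diffop_scale_def Poly_Mapping.map.rep_eq when_def)

global_interpretation pt: vector_space point_scale
  by unfold_locales
    (auto intro!: poly_mapping_eqI simp: lookup_point_scale lookup_add algebra_simps)

global_interpretation op: vector_space diffop_scale
  by unfold_locales
    (auto intro!: poly_mapping_eqI
       simp: lookup_diffop_scale lookup_add algebra_simps single_add
         mult_single mult.assoc [symmetric])

text \<open>
  The library's \<open>dim\<close> is a cardinality and hence \<open>0\<close> on infinite-dimensional spaces. This does not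
  interfere here: each graded piece has coefficients of one fixed degree in \<open>n\<close> variables and is
  therefore finite-dimensional.
\<close>

definition hilbert_series :: "nat \<Rightarrow> nat \<Rightarrow> cpoly \<Rightarrow> rat fps" where
  "hilbert_series n m p =
     Abs_fps (\<lambda>v. of_nat (op.dim {\<delta> \<in> arr_diffops n m p. diffop_homogeneous v \<delta>}))"


definition linear_form :: "nat \<Rightarrow> cpoly \<Rightarrow> bool" where
  "linear_form n l \<longleftrightarrow> l \<in> polys n \<and> homogeneous 1 l"

definition defines_hyperplane :: "nat \<Rightarrow> cpoly \<Rightarrow> point set \<Rightarrow> bool" where
  "defines_hyperplane n l H \<longleftrightarrow>
     linear_form n l \<and> l \<noteq> 0 \<and> H = {v \<in> points n. poly_eval l v = 0}"

definition arrangement :: "nat \<Rightarrow> point set set \<Rightarrow> bool" where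
  "arrangement n A \<longleftrightarrow> finite A \<and> (\<forall>H\<in>A. \<exists>l. defines_hyperplane n l H)"

definition defining_polynomial :: "nat \<Rightarrow> point set set \<Rightarrow> cpoly \<Rightarrow> bool" where
  "defining_polynomial n A p \<longleftrightarrow>
     (\<exists>l. (\<forall>H\<in>A. defines_hyperplane n (l H) H) \<and> p = (\<Prod>H\<in>A. l H))"

text \<open>
  The intersection is taken inside \<open>\<complex>\<^sup>n\<close>, so that the empty intersection is \<open>\<complex>\<^sup>n\<close>.
\<close>

definition generic_arrangement :: "nat \<Rightarrow> point set set \<Rightarrow> bool" where
  "generic_arrangement n A \<longleftrightarrow> arrangement n A \<and>
     (\<forall>B\<subseteq>A. card B \<le> n \<longrightarrow> pt.dim (points n \<inter> \<Inter>B) + card B = n)"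


text \<open>
  A power series in \<open>a\<close> and \<open>b\<close> is a power series in \<open>a\<close> whose coefficients are power
  series in \<open>b\<close>.
\<close>

abbreviation fps_a :: "rat fps fps" where
  "fps_a \<equiv> fps_X"

abbreviation fps_b :: "rat fps fps" where
  "fps_b \<equiv> fps_const fps_X"

text \<open>
  The coefficients of such series do not form a field, but division by a series with nonzero
  constant term is still genuine division.
\<close>

lemma fps_fps_divide_mult:
  fixes f g :: "'a::field fps fps"
  assumes "fps_nth (fps_nth g 0) 0 \<noteq> 0"
  shows "(f / g) * g = f"
proof -
  have g0: "fps_nth g 0 * inverse (fps_nth g 0) = 1"
    using assms by (rule inverse_mult_eq_1')
  have "fps_nth g 0 \<noteq> 0"
    using assms by auto
  hence sd: "subdegree g = 0"
    by (simp add: subdegree_eq_0_iff)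
  have ug: "unit_factor g = g"
    by (simp add: sd fps_unit_factor_def)
  have "g * inverse g = 1"
    using fps_right_inverse[OF g0] by (simp only: fps_inverse_def[of g])
  hence "inverse g * g = 1"
    by (simp only: mult.commute)
  thus ?thesis
    by (simp add: fps_divide_def sd ug mult.assoc)
qed

end

theory Submission
  imports Defs
begin

text \<open>
  Complete the arrangement to a generic family of \<open>m + n - 1\<close> linear forms \<open>l\<^sub>i\<close>. For an index set \<open>J\<close>
  of size \<open>m\<close> let \<open>v\<^sub>J\<close> be the direction of the line on which the other \<open>n - 1\<close> forms vanish. Evaluation
  at the points \<open>v\<^sub>J\<close> shows that the products \<open>l\<^sub>J = \<Prod>\<^sub>i\<^sub>\<in>\<^sub>J l\<^sub>i\<close> form a basis of the polynomials of degree
  \<open>m\<close>, so an operator \<open>\<delta>\<close> of order \<open>m\<close> is given by the arbitrary family of polynomials \<open>\<delta> * l\<^sub>J\<close>.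
  Commutators with linear forms show that \<open>\<delta>\<close> preserves the ideal of the arrangement iff \<open>\<delta> * l\<^sub>J\<close> is
  divisible by every \<open>l\<^sub>i\<close> with \<open>i \<in> J\<close> and \<open>i < r\<close>. Hence the module is free, with one generator of
  degree \<open>card (J \<inter> {..<r})\<close> for each \<open>J\<close>, and its Hilbert series is
  \<open>[a\<^sup>m] (1 + ab)\<^sup>r (1 + a)\<^sup>N / (1 - b)\<^sup>n\<close> with \<open>N = m + n - 1 - r\<close>.
\<close>

section \<open>Polynomials\<close>

text \<open>The size \<open>m + n - 1\<close> is dictated by counting: such a family has as many
  subsets of size \<open>m\<close> as there are monomials of degree \<open>m\<close> in
  \<open>n\<close> variables, and \<open>r \<le> m + n - 1\<close> lets the arrangement fit into it.
  The obstacle is to test divisibility by each \<open>l i\<close> on finitely many products. Modulo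
  \<open>l i\<close>, the operator \<open>f \<mapsto> \<delta> * (l i * f)\<close> is the commutator
  of \<open>\<delta>\<close> with \<open>l i\<close>, which has order \<open>m - 1\<close>, so
  degree \<open>m - 1\<close> decides. There the products of the remaining forms suffice, since
  these number \<open>(m - 1) + n - 1\<close>; times \<open>l i\<close> they are exactly the
  products over the sets \<open>J\<close> that contain \<open>i\<close>. Primality of
  \<open>l i\<close> cancels the other factors of the defining polynomial. The stated series arises
  from the series of the free module by a change of variable: \<open>[a^m] f(a)\<close> is the
  residue of \<open>f(a) / a^(m+1)\<close>, and \<open>a = s / (1 + s)\<close> carries
  \<open>(1 - a + a b)^r / (1 - a)^n\<close> to \<open>(1 + s b)^r (1 + s)^N\<close> with the same
  pole order in \<open>s\<close>.\<close>

abbreviation Co :: "complex \<Rightarrow> cpoly" where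
  "Co c \<equiv> Poly_Mapping.single 0 c"

abbreviation unit_expo :: "nat \<Rightarrow> expo" where
  "unit_expo i \<equiv> Poly_Mapping.single i (Suc 0)"

definition X :: "nat \<Rightarrow> cpoly" where
  "X i = Poly_Mapping.single (unit_expo i) 1"

lemma Co_mult_single [simp]: "Co c * Poly_Mapping.single \<beta> d = Poly_Mapping.single \<beta> (c * d)"
  by (simp add: mult_single)

lemma X_mult_single:
  "X i * Poly_Mapping.single \<beta> d = Poly_Mapping.single (unit_expo i + \<beta>) d"
  by (simp add: X_def mult_single)

lemma Co_mult_Co: "Co (c * d) = Co c * Co d"
  by (simp add: mult_single)

lemma Co_eq_0_iff [simp]: "Co c = 0 \<longleftrightarrow> c = 0"
  by (metis lookup_single_eq lookup_zero single_zero)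

lemma poly_mapping_sum_single:
  fixes f :: "'a \<Rightarrow>\<^sub>0 'b::comm_monoid_add"
  shows "f = (\<Sum>\<beta>\<in>Poly_Mapping.keys f. Poly_Mapping.single \<beta> (Poly_Mapping.lookup f \<beta>))"
  by (intro poly_mapping_eqI)
    (simp add: lookup_sum lookup_single when_def not_in_keys_iff_lookup_eq_zero)

text \<open>The premise for single terms keeps \<open>\<beta> \<in> keys f\<close>, so bounds on the
  degree or the variables of \<open>f\<close> stay available although sums are formed
  freely.\<close>

lemma poly_mapping_single_induct:
  assumes "P 0" "\<And>f g. P f \<Longrightarrow> P g \<Longrightarrow> P (f + g)"
    and "\<And>\<beta> c. \<beta> \<in> Poly_Mapping.keys f \<Longrightarrow> P (Poly_Mapping.single \<beta> c)"
  shows "P (f :: 'a \<Rightarrow>\<^sub>0 'b::comm_monoid_add)"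
proof -
  have "P (\<Sum>\<beta>\<in>B. Poly_Mapping.single \<beta> (Poly_Mapping.lookup f \<beta>))"
    if "finite B" "B \<subseteq> Poly_Mapping.keys f" for B
    using that by (induction B) (auto intro: assms)
  from this[of "Poly_Mapping.keys f"] show ?thesis by (simp flip: poly_mapping_sum_single)
qed

subsection \<open>Exponents\<close>

lemma expos_0 [simp]: "0 \<in> expos n"
  by (simp add: expos_def)

lemma expos_add: "\<alpha> \<in> expos n \<Longrightarrow> \<beta> \<in> expos n \<Longrightarrow> \<alpha> + \<beta> \<in> expos n"
  using Poly_Mapping.keys_add[of \<alpha> \<beta>] by (auto simp: expos_def)

lemma expos_single [simp]: "i < n \<Longrightarrow> Poly_Mapping.single i k \<in> expos n"
  by (auto simp: expos_def)

lemma expo_deg_eq_sum: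
  assumes "finite I" "Poly_Mapping.keys \<alpha> \<subseteq> I"
  shows "expo_deg \<alpha> = (\<Sum>i\<in>I. Poly_Mapping.lookup \<alpha> i)"
  unfolding expo_deg_def
  using assms by (intro sum.mono_neutral_left) (auto simp: not_in_keys_iff_lookup_eq_zero)

lemma expo_deg_expos: "\<alpha> \<in> expos n \<Longrightarrow> expo_deg \<alpha> = (\<Sum>i<n. Poly_Mapping.lookup \<alpha> i)"
  by (intro expo_deg_eq_sum) (auto simp: expos_def)

lemma expo_deg_0 [simp]: "expo_deg 0 = 0"
  by (simp add: expo_deg_def)

lemma expo_deg_add [simp]: "expo_deg (\<alpha> + \<beta>) = expo_deg \<alpha> + expo_deg \<beta>"
proof -
  let ?I = "Poly_Mapping.keys \<alpha> \<union> Poly_Mapping.keys \<beta>"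
  have "expo_deg (\<alpha> + \<beta>) = (\<Sum>i\<in>?I. Poly_Mapping.lookup (\<alpha> + \<beta>) i)"
    using Poly_Mapping.keys_add[of \<alpha> \<beta>] by (intro expo_deg_eq_sum) auto
  also have "\<dots> = expo_deg \<alpha> + expo_deg \<beta>"
    by (simp add: lookup_add sum.distrib expo_deg_eq_sum[of ?I])
  finally show ?thesis .
qed

lemma expo_deg_single [simp]: "expo_deg (Poly_Mapping.single i k) = k"
  by (simp add: expo_deg_def)

lemma expo_deg_eq_0_iff [simp]: "expo_deg \<alpha> = 0 \<longleftrightarrow> \<alpha> = 0"
  by (auto simp: expo_deg_def in_keys_iff intro!: poly_mapping_eqI)

lemma expo_split:
  assumes "0 < Poly_Mapping.lookup \<alpha> i"
  shows "\<alpha> = unit_expo i + (\<alpha> - unit_expo i)"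
  using assms by (intro poly_mapping_eqI) (auto simp: lookup_add lookup_minus lookup_single when_def)

lemma expo_Suc_split:
  assumes "\<alpha> \<in> expos n" "expo_deg \<alpha> = Suc d"
  obtains i \<beta> where "i < n" "\<beta> \<in> expos n" "expo_deg \<beta> = d"
    "\<alpha> = unit_expo i + \<beta>"
proof -
  obtain i where i: "i \<in> Poly_Mapping.keys \<alpha>"
    using assms(2) by (force simp: expo_deg_def)
  then have split: "\<alpha> = unit_expo i + (\<alpha> - unit_expo i)"
    by (intro expo_split) (simp add: in_keys_iff)
  have "expo_deg \<alpha> = 1 + expo_deg (\<alpha> - unit_expo i)"
    by (subst split) simp
  then have "expo_deg (\<alpha> - unit_expo i) = d"
    using assms(2) by simp
  moreover have "\<alpha> - unit_expo i \<in> expos n"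
    using assms(1) by (auto simp: expos_def in_keys_iff lookup_minus subset_iff)
  ultimately show thesis
    using that i assms(1) split by (auto simp: expos_def)
qed

lemma expos_induct [consumes 1, case_names zero step]:
  assumes "\<alpha> \<in> expos n" "P 0"
    and "\<And>i \<beta>. i < n \<Longrightarrow> \<beta> \<in> expos n \<Longrightarrow> P \<beta> \<Longrightarrow> P (unit_expo i + \<beta>)"
  shows "P \<alpha>"
  using assms(1)
proof (induction "expo_deg \<alpha>" arbitrary: \<alpha>)
  case 0
  then show ?case using assms(2) by simp
next
  case (Suc d)
  then show ?case by (metis expo_Suc_split assms(3))
qed

lemma finite_expos_deg: "finite {\<alpha> \<in> expos n. expo_deg \<alpha> = d}"
proof (induction d)
  case 0
  have "{\<alpha> \<in> expos n. expo_deg \<alpha> = 0} \<subseteq> {0}" by auto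
  then show ?case by (rule finite_subset) simp
next
  case (Suc d)
  have "{\<alpha> \<in> expos n. expo_deg \<alpha> = Suc d} \<subseteq>
    (\<lambda>(i, \<beta>). unit_expo i + \<beta>) ` ({..<n} \<times> {\<alpha> \<in> expos n. expo_deg \<alpha> = d})"
  proof
    fix \<alpha> assume "\<alpha> \<in> {\<alpha> \<in> expos n. expo_deg \<alpha> = Suc d}"
    then have "\<alpha> \<in> expos n" "expo_deg \<alpha> = Suc d" by auto
    then obtain i \<beta> where "i < n" "\<beta> \<in> expos n" "expo_deg \<beta> = d" "\<alpha> = unit_expo i + \<beta>"
      by (rule expo_Suc_split)
    then show "\<alpha> \<in> (\<lambda>(i, \<beta>). unit_expo i + \<beta>) ` ({..<n} \<times> {\<alpha> \<in> expos n. expo_deg \<alpha> = d})"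
      by (intro image_eqI[of _ _ "(i, \<beta>)"]) auto
  qed
  then show ?case by (rule finite_subset) (use Suc in simp)
qed

subsection \<open>The polynomial ring\<close>

lemma polys_induct [consumes 1, case_names Co add X]:
  assumes "f \<in> polys n"
    and Co: "\<And>c. P (Co c)" and add: "\<And>f g. P f \<Longrightarrow> P g \<Longrightarrow> P (f + g)"
    and X: "\<And>i f. i < n \<Longrightarrow> f \<in> polys n \<Longrightarrow> P f \<Longrightarrow> P (X i * f)"
  shows "P f"
proof (rule poly_mapping_single_induct)
  show "P 0" using Co[of 0] by simp
next
  fix \<beta> c assume "\<beta> \<in> Poly_Mapping.keys f"
  then have "\<beta> \<in> expos n" using assms(1) by (auto simp: polys_def)
  then show "P (Poly_Mapping.single \<beta> c)"
  proof (induction rule: expos_induct)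
    case (step i \<beta>)
    have "Poly_Mapping.single \<beta> c \<in> polys n"
      using step by (auto simp: polys_def)
    then show ?case
      using X[OF step(1) _ step(3)] by (simp add: X_mult_single)
  qed (simp add: Co)
qed (rule add)

text \<open>A single polynomial involves only finitely many variables, so the induction inside some
  \<open>polys n\<close> applies.\<close>

lemma cpoly_induct [case_names Co add X]:
  fixes f :: cpoly
  assumes Co: "\<And>c. P (Co c)" and add: "\<And>f g. P f \<Longrightarrow> P g \<Longrightarrow> P (f + g)"
    and X: "\<And>i f. P f \<Longrightarrow> P (X i * f)"
  shows "P f"
proof -
  let ?V = "\<Union>(Poly_Mapping.keys ` Poly_Mapping.keys f)"
  have "finite ?V" by simp
  then obtain n where "?V \<subseteq> {..<n}"
    using finite_nat_set_iff_bounded by (meson lessThan_iff subsetI)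
  then have "f \<in> polys n" by (auto simp: polys_def expos_def)
  then show ?thesis by (induction rule: polys_induct) (simp_all add: assms)
qed

lemma polys_0 [simp]: "0 \<in> polys n"
  by (simp add: polys_def)

lemma polys_Co [simp]: "Co c \<in> polys n"
  by (simp add: polys_def)

lemma polys_1 [simp]: "1 \<in> polys n"
  by (simp add: polys_def)

lemma polys_single [simp]: "\<beta> \<in> expos n \<Longrightarrow> Poly_Mapping.single \<beta> c \<in> polys n"
  by (simp add: polys_def)

lemma polys_add: "f \<in> polys n \<Longrightarrow> g \<in> polys n \<Longrightarrow> f + g \<in> polys n"
  using Poly_Mapping.keys_add[of f g] by (auto simp: polys_def)

lemma polys_mult: "f \<in> polys n \<Longrightarrow> g \<in> polys n \<Longrightarrow> f * g \<in> polys n"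
  using keys_mult[of f g] by (fastforce simp: polys_def intro: expos_add)

lemma polys_sum: "(\<And>i. i \<in> I \<Longrightarrow> f i \<in> polys n) \<Longrightarrow> (\<Sum>i\<in>I. f i) \<in> polys n"
  by (induction I rule: infinite_finite_induct) (auto intro: polys_add)

lemma polys_prod: "(\<And>i. i \<in> I \<Longrightarrow> f i \<in> polys n) \<Longrightarrow> (\<Prod>i\<in>I. f i) \<in> polys n"
  by (induction I rule: infinite_finite_induct) (auto intro: polys_mult)

section \<open>Homogeneous polynomials in \<open>n\<close> variables\<close>

definition homs :: "nat \<Rightarrow> nat \<Rightarrow> cpoly set" where
  "homs n d = {f \<in> polys n. homogeneous d f}"

lemma homs_iff: "f \<in> homs n d \<longleftrightarrow> Poly_Mapping.keys f \<subseteq> {\<alpha> \<in> expos n. expo_deg \<alpha> = d}"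
  by (auto simp: homs_def polys_def homogeneous_def)

lemma homs_polys: "f \<in> homs n d \<Longrightarrow> f \<in> polys n"
  by (simp add: homs_def)

lemma homs_0 [simp]: "0 \<in> homs n d"
  by (simp add: homs_iff)

lemma homs_1 [simp]: "1 \<in> homs n 0"
  by (simp add: homs_iff)

lemma homs_single [simp]: "\<beta> \<in> expos n \<Longrightarrow> expo_deg \<beta> = d \<Longrightarrow> Poly_Mapping.single \<beta> c \<in> homs n d"
  by (simp add: homs_iff)

lemma homs_add: "f \<in> homs n d \<Longrightarrow> g \<in> homs n d \<Longrightarrow> f + g \<in> homs n d"
  using Poly_Mapping.keys_add[of f g] by (auto simp: homs_iff)

lemma homs_mult: "f \<in> homs n d \<Longrightarrow> g \<in> homs n e \<Longrightarrow> f * g \<in> homs n (d + e)"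
  using keys_mult[of f g] by (fastforce simp: homs_iff intro: expos_add)

lemma homs_Co_mult: "f \<in> homs n d \<Longrightarrow> Co c * f \<in> homs n d"
  using homs_mult[of "Co c" n 0 f d] by simp

lemma homs_sum: "(\<And>i. i \<in> I \<Longrightarrow> f i \<in> homs n d) \<Longrightarrow> (\<Sum>i\<in>I. f i) \<in> homs n d"
  by (induction I rule: infinite_finite_induct) (auto intro: homs_add)

lemma homs_prod:
  "finite I \<Longrightarrow> (\<And>i. i \<in> I \<Longrightarrow> f i \<in> homs n 1) \<Longrightarrow> (\<Prod>i\<in>I. f i) \<in> homs n (card I)"
proof (induction I rule: finite_induct)
  case (insert x F)
  then have "f x * prod f F \<in> homs n (1 + card F)" by (intro homs_mult) auto
  with insert show ?case by simp
qed simp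

text \<open>The case \<open>X\<close> offers no hypothesis about \<open>g\<close>, whose degree is
  \<open>d\<close> and not \<open>Suc d\<close>; an outer induction on the degree or on the order of
  an operator supplies it.\<close>

lemma homs_Suc_induct [consumes 1, case_names zero add X]:
  assumes "f \<in> homs n (Suc d)"
    and zero: "P 0" and add: "\<And>f g. P f \<Longrightarrow> P g \<Longrightarrow> P (f + g)"
    and X: "\<And>i g. i < n \<Longrightarrow> g \<in> homs n d \<Longrightarrow> P (X i * g)"
  shows "P f"
proof (rule poly_mapping_single_induct)
  fix \<beta> c assume "\<beta> \<in> Poly_Mapping.keys f"
  then have "\<beta> \<in> expos n" "expo_deg \<beta> = Suc d" using assms(1) by (auto simp: homs_iff)
  then obtain i \<gamma> where "i < n" "\<gamma> \<in> expos n" "expo_deg \<gamma> = d"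
    "\<beta> = unit_expo i + \<gamma>" by (rule expo_Suc_split)
  then show "P (Poly_Mapping.single \<beta> c)"
    using X[of i "Poly_Mapping.single \<gamma> c"] by (simp add: X_mult_single)
qed (use zero add in auto)

lemma homs_0_Co: "f \<in> homs n 0 \<Longrightarrow> f = Co (Poly_Mapping.lookup f 0)"
  by (intro poly_mapping_eqI)
    (force simp: homs_iff lookup_single when_def not_in_keys_iff_lookup_eq_zero[symmetric])

lemma homs_1_sum:
  assumes "f \<in> homs n 1"
  shows "f = (\<Sum>i<n. Co (Poly_Mapping.lookup f (unit_expo i)) * X i)"
proof -
  have inj: "inj_on unit_expo {..<n}"
    by (metis (no_types, lifting) inj_onI lookup_single_eq lookup_single_not_eq nat.distinct(1))
  have "Poly_Mapping.keys f \<subseteq> unit_expo ` {..<n}"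
  proof
    fix \<alpha> assume "\<alpha> \<in> Poly_Mapping.keys f"
    then have "\<alpha> \<in> expos n" "expo_deg \<alpha> = Suc 0" using assms by (auto simp: homs_iff)
    then show "\<alpha> \<in> unit_expo ` {..<n}"
      by (rule expo_Suc_split) auto
  qed
  then have "f = (\<Sum>\<beta>\<in>unit_expo ` {..<n}. Poly_Mapping.single \<beta> (Poly_Mapping.lookup f \<beta>))"
    by (subst poly_mapping_sum_single, intro sum.mono_neutral_left) (auto simp: in_keys_iff)
  then show ?thesis
    using inj by (simp add: sum.reindex X_def)
qed

section \<open>Homogeneous components\<close>

definition hom_component :: "nat \<Rightarrow> cpoly \<Rightarrow> cpoly" where
  "hom_component d f = (\<Sum>\<beta>\<in>{\<beta> \<in> Poly_Mapping.keys f. expo_deg \<beta> = d}.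
     Poly_Mapping.single \<beta> (Poly_Mapping.lookup f \<beta>))"

lemma lookup_hom_component:
  "Poly_Mapping.lookup (hom_component d f) \<alpha> = (if expo_deg \<alpha> = d then Poly_Mapping.lookup f \<alpha> else 0)"
  by (auto simp: hom_component_def lookup_sum lookup_single when_def not_in_keys_iff_lookup_eq_zero)

lemma hom_component_add: "hom_component d (f + g) = hom_component d f + hom_component d g"
  by (intro poly_mapping_eqI) (simp add: lookup_hom_component lookup_add)

lemma hom_component_single:
  "hom_component d (Poly_Mapping.single \<beta> c) = (if expo_deg \<beta> = d then Poly_Mapping.single \<beta> c else 0)"
  by (intro poly_mapping_eqI) (auto simp: lookup_hom_component lookup_single when_def)

lemma hom_component_in_homs: "f \<in> polys n \<Longrightarrow> hom_component d f \<in> homs n d"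
  by (auto simp: homs_iff polys_def in_keys_iff lookup_hom_component split: if_splits)

lemma hom_component_homs: "f \<in> homs n d \<Longrightarrow> hom_component e f = (if e = d then f else 0)"
  by (intro poly_mapping_eqI)
    (auto simp: lookup_hom_component homs_iff not_in_keys_iff_lookup_eq_zero[symmetric])

text \<open>Comparing components on both sides of a factorisation and cancelling \<open>f\<close>
  yields the degree of the quotient.\<close>

lemma hom_component_mult:
  assumes "f \<in> homs n d"
  shows "hom_component e (f * g) = (if d \<le> e then f * hom_component (e - d) g else 0)"
proof (induction g rule: poly_mapping_single_induct)
  case 1
  then show ?case by (simp add: hom_component_def)
next
  case (2 g h)
  then show ?case by (simp add: hom_component_add algebra_simps)
next
  case (3 \<beta> c)
  show ?case
  proof (rule poly_mapping_single_induct[of _ f])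
    show "hom_component e (0 * Poly_Mapping.single \<beta> c) =
      (if d \<le> e then 0 * hom_component (e - d) (Poly_Mapping.single \<beta> c) else 0)"
      by (simp add: hom_component_def)
  next
    fix \<alpha> c' assume "\<alpha> \<in> Poly_Mapping.keys f"
    then have "expo_deg \<alpha> = d" using assms by (auto simp: homs_iff)
    then show "hom_component e (Poly_Mapping.single \<alpha> c' * Poly_Mapping.single \<beta> c) =
      (if d \<le> e then Poly_Mapping.single \<alpha> c' * hom_component (e - d) (Poly_Mapping.single \<beta> c) else 0)"
      by (auto simp: mult_single hom_component_single)
  qed (simp add: hom_component_add algebra_simps)
qed

subsection \<open>Substitution\<close>

text \<open>The coefficient map \<open>c\<close> is a parameter so that one construction serves
  twice: with constants as coefficients it gives endomorphisms of the polynomial ring, with the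
  identity it gives evaluation at a point.\<close>

definition psub :: "(complex \<Rightarrow> 'b::comm_ring_1) \<Rightarrow> (nat \<Rightarrow> 'b) \<Rightarrow> cpoly \<Rightarrow> 'b" where
  "psub c \<theta> f = (\<Sum>\<beta>\<in>Poly_Mapping.keys f. c (Poly_Mapping.lookup f \<beta>) *
     (\<Prod>i\<in>Poly_Mapping.keys \<beta>. \<theta> i ^ Poly_Mapping.lookup \<beta> i))"

locale coeff_hom =
  fixes c :: "complex \<Rightarrow> 'b::comm_ring_1"
  assumes c_add: "c (x + y) = c x + c y" and c_mult: "c (x * y) = c x * c y" and c_1: "c 1 = 1"
begin

lemma c_0: "c 0 = 0"
  using c_add[of 0 0] by simp

lemma psub_superset:
  assumes "finite B" "Poly_Mapping.keys f \<subseteq> B"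
  shows "psub c \<theta> f = (\<Sum>\<beta>\<in>B. c (Poly_Mapping.lookup f \<beta>) *
     (\<Prod>i\<in>Poly_Mapping.keys \<beta>. \<theta> i ^ Poly_Mapping.lookup \<beta> i))"
  unfolding psub_def using assms
  by (intro sum.mono_neutral_left) (auto simp: in_keys_iff c_0)

lemma psub_add: "psub c \<theta> (f + g) = psub c \<theta> f + psub c \<theta> g"
proof -
  let ?B = "Poly_Mapping.keys f \<union> Poly_Mapping.keys g"
  have "Poly_Mapping.keys (f + g) \<subseteq> ?B" by (rule Poly_Mapping.keys_add)
  then show ?thesis
    by (simp add: psub_superset[of ?B] lookup_add c_add distrib_right sum.distrib)
qed

lemma psub_single:
  "psub c \<theta> (Poly_Mapping.single \<beta> a) =
    c a * (\<Prod>i\<in>Poly_Mapping.keys \<beta>. \<theta> i ^ Poly_Mapping.lookup \<beta> i)"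
  by (simp add: psub_def c_0)

lemma psub_Co [simp]: "psub c \<theta> (Co a) = c a"
  by (simp add: psub_single)

lemma psub_0 [simp]: "psub c \<theta> 0 = 0"
  by (simp add: psub_def)

lemma psub_1 [simp]: "psub c \<theta> 1 = 1"
  using psub_Co[of \<theta> 1] by (simp add: c_1)

lemma psub_X [simp]: "psub c \<theta> (X i) = \<theta> i"
  by (simp add: X_def psub_single c_1)

lemma psub_X_mult: "psub c \<theta> (X i * f) = \<theta> i * psub c \<theta> f"
proof (induction f rule: poly_mapping_single_induct)
  case (3 \<beta> a)
  \<comment> \<open>Over one common index set the exponents add up factor by factor.\<close>
  define I where "I = insert i (Poly_Mapping.keys \<beta>)"
  have *: "(\<Prod>k\<in>Poly_Mapping.keys \<gamma>. \<theta> k ^ Poly_Mapping.lookup \<gamma> k) =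
      (\<Prod>k\<in>I. \<theta> k ^ Poly_Mapping.lookup \<gamma> k)" if "Poly_Mapping.keys \<gamma> \<subseteq> I" for \<gamma>
    using that by (intro prod.mono_neutral_left) (auto simp: in_keys_iff I_def)
  have "Poly_Mapping.keys (unit_expo i + \<beta>) \<subseteq> I"
    using Poly_Mapping.keys_add[of "unit_expo i" \<beta>] by (auto simp: I_def)
  note sum = *[OF this]
  have unit: "(\<Prod>k\<in>I. \<theta> k ^ Poly_Mapping.lookup (unit_expo i) k) = \<theta> i"
    by (subst *[symmetric]) (auto simp: I_def)
  have \<beta>: "Poly_Mapping.keys \<beta> \<subseteq> I" by (auto simp: I_def)
  show ?case
    unfolding X_mult_single psub_single sum *[OF \<beta>]
    by (simp add: lookup_add power_add prod.distrib unit mult.left_commute)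
qed (simp_all add: psub_add distrib_left)

lemma psub_Co_mult: "psub c \<theta> (Co a * f) = c a * psub c \<theta> f"
  by (induction f rule: poly_mapping_single_induct)
    (simp_all add: psub_add distrib_left psub_single c_mult mult.assoc)

lemma psub_mult: "psub c \<theta> (f * g) = psub c \<theta> f * psub c \<theta> g"
  by (induction f rule: cpoly_induct)
    (simp_all add: psub_Co_mult psub_X_mult psub_add distrib_right mult.assoc)

lemma psub_sum: "psub c \<theta> (\<Sum>i\<in>I. f i) = (\<Sum>i\<in>I. psub c \<theta> (f i))"
  by (induction I rule: infinite_finite_induct) (auto simp: psub_add)

lemma psub_prod: "psub c \<theta> (\<Prod>i\<in>I. f i) = (\<Prod>i\<in>I. psub c \<theta> (f i))"
  by (induction I rule: infinite_finite_induct) (auto simp: psub_mult)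

end

interpretation Co: coeff_hom "Poly_Mapping.single 0 :: complex \<Rightarrow> cpoly"
  by standard (simp_all add: single_add Co_mult_Co del: Co_mult_single)

interpretation eval: coeff_hom "\<lambda>x::complex. x"
  by standard auto

lemma poly_eval_psub: "poly_eval f v = psub (\<lambda>x. x) (Poly_Mapping.lookup v) f"
  by (simp add: poly_eval_def psub_def)

lemma psub_polys:
  assumes "\<And>i. \<theta> i \<in> polys n"
  shows "psub (Poly_Mapping.single 0) \<theta> f \<in> polys n"
  by (induction f rule: cpoly_induct)
    (auto simp: Co.psub_add Co.psub_X_mult intro: polys_add polys_mult assms)

text \<open>Setting the variables of index at least \<open>n\<close> to zero retracts the ambient ring onto
  \<open>polys n\<close>, so divisibility in the ambient ring agrees with divisibility in \<open>polys n\<close>.\<close>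

lemma quotient_in_polys:
  assumes "f * q \<in> polys n" "f \<in> polys n" "f \<noteq> 0"
  shows "q \<in> polys n"
proof -
  define \<rho> where "\<rho> = psub (Poly_Mapping.single 0) (\<lambda>i. if i < n then X i else 0)"
  have X: "X i \<in> polys n" if "i < n" for i using that by (simp add: X_def)
  have \<rho>: "\<rho> g \<in> polys n" for g
    unfolding \<rho>_def by (rule psub_polys) (simp add: X)
  have id: "\<rho> g = g" if "g \<in> polys n" for g
    using that unfolding \<rho>_def
    by (induction rule: polys_induct) (simp_all add: Co.psub_add Co.psub_X_mult)
  have "f * q = \<rho> (f * q)" using assms by (simp add: id)
  also have "\<dots> = f * \<rho> q" using assms by (simp add: \<rho>_def Co.psub_mult id[unfolded \<rho>_def])
  finally have "q = \<rho> q" using assms(3) by simp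
  with \<rho>[of q] show ?thesis by simp
qed

lemma quotient_in_homs:
  assumes "f * q \<in> homs n (d + e)" "f \<in> homs n d" "f \<noteq> 0"
  shows "q \<in> homs n e"
proof -
  have "q \<in> polys n"
    using assms by (auto intro: quotient_in_polys homs_polys)
  have "f * q = hom_component (d + e) (f * q)" using hom_component_homs[OF assms(1)] by simp
  also have "\<dots> = f * hom_component e q" using hom_component_mult[OF assms(2), of "d + e" q] by simp
  finally have "q = hom_component e q" using assms(3) by simp
  with hom_component_in_homs[OF \<open>q \<in> polys n\<close>, of e] show ?thesis by simp
qed

lemma quotient_eq_0_if_degree_less:
  assumes "f * q \<in> homs n e" "f \<in> homs n d" "f \<noteq> 0" "e < d"
  shows "q = 0"
proof -
  have "f * q = hom_component e (f * q)" using hom_component_homs[OF assms(1)] by simp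
  also have "\<dots> = 0" using hom_component_mult[OF assms(2), of e q] assms(4) by simp
  finally show ?thesis using assms(3) by simp
qed

lemma principal_ideal_iff:
  assumes "p \<in> polys n" "p \<noteq> 0"
  shows "f \<in> principal_ideal n p \<longleftrightarrow> f \<in> polys n \<and> p dvd f"
  using assms quotient_in_polys[of p _ n]
  by (auto simp: principal_ideal_def dvd_def mult.commute intro: polys_mult)

subsection \<open>Linear forms\<close>

lemma linear_form_iff: "linear_form n l \<longleftrightarrow> l \<in> homs n 1"
  by (simp add: linear_form_def homs_def)

abbreviation lcoeff :: "cpoly \<Rightarrow> nat \<Rightarrow> complex" where
  "lcoeff l i \<equiv> Poly_Mapping.lookup l (unit_expo i)"

text \<open>Modulo \<open>l\<close> one variable occurring in \<open>l\<close> can be eliminated, and the elimination is a ring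
  homomorphism with kernel generated by \<open>l\<close>.\<close>

lemma linear_form_prime:
  assumes l: "l \<in> homs n 1" "l \<noteq> 0" and dvd: "l dvd f * g"
  shows "l dvd f \<or> l dvd g"
proof -
  have l_sum: "l = (\<Sum>i<n. Co (lcoeff l i) * X i)"
    using homs_1_sum[OF l(1)] by simp
  obtain k where k: "k < n" "lcoeff l k \<noteq> 0"
    using l_sum l(2) by (metis (no_types, lifting) lessThan_iff mult_zero_left single_zero sum.neutral)
  \<comment> \<open>Scaling makes the coefficient of \<open>X k\<close> in \<open>u\<close> equal to
    1, so \<open>X k - u\<close> expresses \<open>X k\<close> modulo \<open>l\<close> through the
    other variables.\<close>
  define u where "u = Co (inverse (lcoeff l k)) * l"
  define \<theta> where "\<theta> i = (if i = k then X k - u else X i)" for i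
  define \<sigma> where "\<sigma> = psub (Poly_Mapping.single 0) \<theta>"
  have "\<sigma> l = (\<Sum>i<n. Co (lcoeff l i) * \<theta> i)"
    by (subst l_sum) (simp add: \<sigma>_def Co.psub_sum Co.psub_Co_mult)
  also have "\<dots> = Co (lcoeff l k) * \<theta> k + (\<Sum>i\<in>{..<n} - {k}. Co (lcoeff l i) * \<theta> i)"
    using k by (subst sum.remove[of _ k]) auto
  also have "\<dots> = Co (lcoeff l k) * X k + (\<Sum>i\<in>{..<n} - {k}. Co (lcoeff l i) * X i) - Co (lcoeff l k) * u"
    by (simp add: \<theta>_def algebra_simps)
  also have "\<dots> = l - Co (lcoeff l k) * u"
    using l_sum k by (simp add: sum.remove[of "{..<n}" k])
  also have "Co (lcoeff l k) * u = l"
    using k by (simp add: u_def mult.assoc[symmetric])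
  finally have \<sigma>l: "\<sigma> l = 0" by simp
  have cong: "l dvd h - \<sigma> h" for h
  proof (induction h rule: cpoly_induct)
    case (Co c)
    then show ?case by (simp add: \<sigma>_def)
  next
    case (add f g)
    then have "l dvd (f - \<sigma> f) + (g - \<sigma> g)" by (rule dvd_add)
    then show ?case by (simp add: \<sigma>_def Co.psub_add algebra_simps)
  next
    case (X i f)
    have "l dvd X i - \<theta> i" by (simp add: \<theta>_def u_def)
    then have "l dvd X i * (f - \<sigma> f) + (X i - \<theta> i) * \<sigma> f"
      using X by (intro dvd_add dvd_mult dvd_mult2)
    then show ?case by (simp add: \<sigma>_def Co.psub_X_mult) (simp add: algebra_simps)
  qed
  obtain h where "f * g = l * h" using dvd by (elim dvdE)
  \<comment> \<open>There are no zero divisors, so the elimination kills one of the factors, and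
    \<open>cong\<close> turns this into divisibility.\<close>
  then have "\<sigma> f * \<sigma> g = 0"
    using \<sigma>l by (metis Co.psub_mult \<sigma>_def mult_zero_left)
  then show ?thesis
    using cong[of f] cong[of g] by auto
qed

lemma linear_form_not_dvd_1:
  assumes "l \<in> homs n 1" "l \<noteq> 0"
  shows "\<not> l dvd 1"
proof
  assume "l dvd 1"
  then obtain q where q: "1 = l * q" by (elim dvdE)
  then have "q = 0"
    using quotient_eq_0_if_degree_less[of l q n 0 1] assms by (simp flip: q)
  with q show False by simp
qed

lemma linear_form_not_dvd_prod:
  assumes "l \<in> homs n 1" "l \<noteq> 0" "\<And>i. i \<in> I \<Longrightarrow> \<not> l dvd f i"
  shows "\<not> l dvd (\<Prod>i\<in>I. f i)"
  using assms(3)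
proof (induction I rule: infinite_finite_induct)
  case (insert i I)
  then show ?case using linear_form_prime[OF assms(1,2), of "f i" "prod f I"] by auto
qed (use assms(1,2) linear_form_not_dvd_1 in auto)

text \<open>Replaces unique factorisation: the prime \<open>l j\<close> divides none of the factors
  already split off, hence it divides the cofactor.\<close>

lemma prod_dvdI:
  fixes l :: "'i \<Rightarrow> cpoly"
  assumes "finite I" "\<And>i. i \<in> I \<Longrightarrow> l i \<in> homs n 1 \<and> l i \<noteq> 0"
    and "\<And>i j. i \<in> I \<Longrightarrow> j \<in> I \<Longrightarrow> i \<noteq> j \<Longrightarrow> \<not> l i dvd l j"
    and "\<And>i. i \<in> I \<Longrightarrow> l i dvd f"
  shows "(\<Prod>i\<in>I. l i) dvd f"
  using assms
proof (induction I rule: finite_induct)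
  case (insert j I)
  then obtain g where g: "f = (\<Prod>i\<in>I. l i) * g" by (auto elim: dvdE)
  have "\<not> l j dvd (\<Prod>i\<in>I. l i)"
    using linear_form_not_dvd_prod[of "l j" n I l] insert.prems insert.hyps by auto
  then have "l j dvd g"
    using linear_form_prime[of "l j" n "\<Prod>i\<in>I. l i" g] insert.prems g by auto
  then show ?case using insert.hyps g by (auto simp: mult.commute mult_dvd_mono)
qed simp

section \<open>Evaluation at points\<close>

lemma poly_eval_mult: "poly_eval (f * g) v = poly_eval f v * poly_eval g v"
  by (simp add: poly_eval_psub eval.psub_mult)

lemma poly_eval_prod: "poly_eval (\<Prod>i\<in>I. f i) v = (\<Prod>i\<in>I. poly_eval (f i) v)"
  by (simp add: poly_eval_psub eval.psub_prod)

lemma poly_eval_linear_form: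
  assumes "l \<in> homs n 1"
  shows "poly_eval l v = (\<Sum>i<n. lcoeff l i * Poly_Mapping.lookup v i)"
  unfolding poly_eval_psub
  by (subst homs_1_sum[OF assms]) (simp add: eval.psub_sum eval.psub_Co_mult)

lemma poly_eval_linear_add:
  "l \<in> homs n 1 \<Longrightarrow> poly_eval l (v + w) = poly_eval l v + poly_eval l w"
  by (simp add: poly_eval_linear_form lookup_add distrib_left sum.distrib)

lemma poly_eval_linear_scale:
  "l \<in> homs n 1 \<Longrightarrow> poly_eval l (point_scale c v) = c * poly_eval l v"
  by (simp add: poly_eval_linear_form lookup_point_scale sum_distrib_left mult.left_commute)

section \<open>Differential operators\<close>

lemma partial_deriv_superset:
  assumes "finite B" "Poly_Mapping.keys f \<subseteq> B"
  shows "partial_deriv i f = (\<Sum>\<beta>\<in>B. Poly_Mapping.single (\<beta> - unit_expo i)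
    (of_nat (Poly_Mapping.lookup \<beta> i) * Poly_Mapping.lookup f \<beta>))"
  unfolding partial_deriv_def One_nat_def using assms
  by (intro sum.mono_neutral_left) (auto simp: in_keys_iff)

lemma partial_deriv_0 [simp]: "partial_deriv i 0 = 0"
  by (simp add: partial_deriv_def)

lemma partial_deriv_add: "partial_deriv i (f + g) = partial_deriv i f + partial_deriv i g"
proof -
  let ?B = "Poly_Mapping.keys f \<union> Poly_Mapping.keys g"
  have "Poly_Mapping.keys (f + g) \<subseteq> ?B" by (rule Poly_Mapping.keys_add)
  then show ?thesis
    by (simp add: partial_deriv_superset[of ?B] lookup_add distrib_left single_add sum.distrib)
qed

lemma partial_deriv_single:
  "partial_deriv i (Poly_Mapping.single \<beta> c) =
    Poly_Mapping.single (\<beta> - unit_expo i) (of_nat (Poly_Mapping.lookup \<beta> i) * c)"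
  by (simp add: partial_deriv_def)

text \<open>The Leibniz rule is needed only for a factor \<open>X j\<close>, because
  \<open>diff_order\<close> is tested by commutators with variables.\<close>

lemma partial_deriv_X_mult:
  "partial_deriv i (X j * f) = X j * partial_deriv i f + (if i = j then f else 0)"
proof (induction f rule: poly_mapping_single_induct)
  case (3 \<beta> c)
  \<comment> \<open>With truncated subtraction the shift needs a positive exponent at
    \<open>i\<close>; otherwise the derivative of the term is 0.\<close>
  have "unit_expo j + \<beta> - unit_expo i = unit_expo j + (\<beta> - unit_expo i)"
    if "0 < Poly_Mapping.lookup \<beta> i"
    using that by (intro poly_mapping_eqI) (auto simp: lookup_add lookup_minus lookup_single when_def)
  then show ?case
    by (cases "Poly_Mapping.lookup \<beta> i = 0")
      (auto simp: X_mult_single partial_deriv_single lookup_add lookup_single when_def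
         single_add[symmetric] algebra_simps)
qed (auto simp: partial_deriv_add distrib_left)

lemma partial_deriv_Co_mult: "partial_deriv i (Co c * f) = Co c * partial_deriv i f"
  by (induction f rule: poly_mapping_single_induct)
    (simp_all add: partial_deriv_add distrib_left partial_deriv_single mult.left_commute)

lemma partial_deriv_1 [simp]: "partial_deriv i 1 = 0"
  using partial_deriv_single[of i 0 1] by simp

lemma partial_deriv_polys: "f \<in> polys n \<Longrightarrow> partial_deriv i f \<in> polys n"
  unfolding partial_deriv_def
  by (intro polys_sum polys_single) (auto simp: polys_def expos_def in_keys_iff lookup_minus subset_iff)

text \<open>Grothendieck's inductive definition of differential operators, restricted to operators
  that are homogeneous of order \<open>k\<close>, i.e. without lower order terms.\<close>

fun diff_order :: "nat \<Rightarrow> nat \<Rightarrow> (cpoly \<Rightarrow> cpoly) \<Rightarrow> bool" where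
  "diff_order n 0 E \<longleftrightarrow> (\<forall>f. E f = f * E 1)"
| "diff_order n (Suc k) E \<longleftrightarrow> (\<forall>f g. E (f + g) = E f + E g) \<and> (\<forall>c f. E (Co c * f) = Co c * E f) \<and>
     E 1 = 0 \<and> (\<forall>i<n. diff_order n k (\<lambda>f. E (X i * f) - X i * E f))"

declare diff_order.simps [simp del]

lemma diff_order_0D: "diff_order n 0 E \<Longrightarrow> E f = f * E 1"
  unfolding diff_order.simps by blast

lemma diff_order_0I: "(\<And>f. E f = f * g) \<Longrightarrow> diff_order n 0 E"
  unfolding diff_order.simps by (metis mult_1_left)

lemma diff_order_SucD:
  assumes "diff_order n (Suc k) E"
  shows "E 1 = 0" "i < n \<Longrightarrow> diff_order n k (\<lambda>f. E (X i * f) - X i * E f)"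
  using assms unfolding diff_order.simps by blast+

lemma diff_order_linear:
  assumes "diff_order n k E"
  shows "E (f + g) = E f + E g" "E (Co c * f) = Co c * E f" "E 0 = 0"
proof -
  show "E (f + g) = E f + E g"
  proof (cases k)
    case 0
    then show ?thesis using assms by (metis diff_order_0D distrib_right)
  next
    case (Suc k')
    then show ?thesis using assms unfolding Suc diff_order.simps by blast
  qed
  show Co: "E (Co c * f) = Co c * E f" for c f
  proof (cases k)
    case 0
    then show ?thesis using assms by (metis diff_order_0D mult.assoc)
  next
    case (Suc k')
    then show ?thesis using assms unfolding Suc diff_order.simps by blast
  qed
  show "E 0 = 0" using Co[of 0 0] by simp
qed

lemma diff_order_zero: "diff_order n k (\<lambda>f. 0)"
  by (induction k) (auto simp: diff_order.simps)

lemma diff_order_add: "diff_order n k E \<Longrightarrow> diff_order n k F \<Longrightarrow> diff_order n k (\<lambda>f. E f + F f)"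
proof (induction k arbitrary: E F)
  case 0
  show ?case
    by (rule diff_order_0I[where g = "E 1 + F 1"])
      (metis 0 diff_order_0D distrib_left)
next
  case (Suc k)
  have "diff_order n k (\<lambda>f. (E (X i * f) - X i * E f) + (F (X i * f) - X i * F f))" if "i < n" for i
    using Suc.IH Suc.prems[THEN diff_order_SucD(2)] that by blast
  then show ?case
    using Suc.prems[THEN diff_order_linear(1)] Suc.prems[THEN diff_order_linear(2)]
      Suc.prems[THEN diff_order_SucD(1)]
    unfolding diff_order.simps(2) by (simp add: algebra_simps)
qed

lemma diff_order_mult: "diff_order n k E \<Longrightarrow> diff_order n k (\<lambda>f. h * E f)"
proof (induction k arbitrary: E)
  case 0
  show ?case
    using diff_order_0D[OF 0] by (intro diff_order_0I[where g = "h * E 1"]) (metis mult.left_commute)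
next
  case (Suc k)
  have "diff_order n k (\<lambda>f. h * (E (X i * f) - X i * E f))" if "i < n" for i
    using Suc.IH Suc.prems[THEN diff_order_SucD(2)] that by blast
  then show ?case
    using Suc.prems[THEN diff_order_linear(1)] Suc.prems[THEN diff_order_linear(2)]
      Suc.prems[THEN diff_order_SucD(1)]
    unfolding diff_order.simps(2) by (simp add: algebra_simps)
qed

lemma diff_order_sum:
  "(\<And>a. a \<in> A \<Longrightarrow> diff_order n k (E a)) \<Longrightarrow> diff_order n k (\<lambda>f. \<Sum>a\<in>A. E a f)"
  by (induction A rule: infinite_finite_induct) (auto intro: diff_order_zero diff_order_add)

text \<open>The commutator of the composite with \<open>X j\<close> is the commutator of
  \<open>E\<close> with \<open>X j\<close>, composed with the derivative, plus \<open>E\<close>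
  itself if \<open>i = j\<close>. The first summand is covered by induction, the second has the
  right order already.\<close>

lemma diff_order_partial_deriv:
  "diff_order n k E \<Longrightarrow> diff_order n (Suc k) (\<lambda>f. E (partial_deriv i f))"
proof (induction k arbitrary: E)
  case 0
  note E = diff_order_0D[OF 0]
  have "E (partial_deriv i (X j * f)) - X j * E (partial_deriv i f) = (if i = j then E f else 0)" for j f
    using E[of "X j * partial_deriv i f"] E[of "partial_deriv i f"]
    by (cases "i = j") (simp_all add: partial_deriv_X_mult diff_order_linear[OF 0] mult.assoc)
  moreover have "diff_order n 0 (\<lambda>f. if i = j then E f else 0)" for j
    using 0 diff_order_zero[of n 0] by (cases "i = j") simp_all
  ultimately show ?case
    unfolding diff_order.simps(2)[of n 0]
    using diff_order_linear[OF 0]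
    by (simp add: partial_deriv_add partial_deriv_Co_mult)
next
  case (Suc k)
  have *: "E (partial_deriv i (X j * f)) - X j * E (partial_deriv i f) =
      (E (X j * partial_deriv i f) - X j * E (partial_deriv i f)) + (if i = j then E f else 0)" for j f
    using diff_order_linear[OF Suc.prems] by (simp add: partial_deriv_X_mult)
  have "diff_order n (Suc k) (\<lambda>f. if i = j then E f else 0)" for j
    using Suc.prems diff_order_zero[of n "Suc k"] by (cases "i = j") simp_all
  moreover have "diff_order n (Suc k) (\<lambda>f. E (X j * partial_deriv i f) - X j * E (partial_deriv i f))"
    if "j < n" for j
    using that Suc.prems[THEN diff_order_SucD(2)] by (intro Suc.IH) blast
  ultimately have "diff_order n (Suc k)
      (\<lambda>f. E (partial_deriv i (X j * f)) - X j * E (partial_deriv i f))" if "j < n" for j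
    unfolding * using that by (intro diff_order_add)
  then show ?case
    unfolding diff_order.simps(2)[of n "Suc k"]
    using diff_order_linear[OF Suc.prems]
    by (simp add: partial_deriv_add partial_deriv_Co_mult)
qed

lemma diff_order_funpow_partial_deriv:
  "diff_order n k E \<Longrightarrow> diff_order n (k + a) (\<lambda>f. E ((partial_deriv i ^^ a) f))"
proof (induction a)
  case (Suc a)
  then have "diff_order n (Suc (k + a)) (\<lambda>f. E ((partial_deriv i ^^ a) (partial_deriv i f)))"
    by (intro diff_order_partial_deriv[where E = "\<lambda>f. E ((partial_deriv i ^^ a) f)"])
  then show ?case by (simp add: funpow_swap1)
qed (simp)

text \<open>The outer operator \<open>E\<close> is general so that the induction can absorb the
  outermost power of a derivative into it.\<close>

lemma diff_order_foldr_partial_deriv: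
  "diff_order n k E \<Longrightarrow>
    diff_order n (k + sum_list (map a xs)) (\<lambda>f. E (foldr (\<lambda>i. partial_deriv i ^^ a i) xs f))"
proof (induction xs arbitrary: k E)
  case (Cons i xs)
  then have "diff_order n (k + a i + sum_list (map a xs))
      (\<lambda>f. E ((partial_deriv i ^^ a i) (foldr (\<lambda>i. partial_deriv i ^^ a i) xs f)))"
    by (intro Cons.IH[where E = "\<lambda>f. E ((partial_deriv i ^^ a i) f)"] diff_order_funpow_partial_deriv)
  then show ?case by (simp add: add.assoc)
qed (simp)

lemma diff_order_iter_deriv:
  assumes "\<alpha> \<in> expos n"
  shows "diff_order n (expo_deg \<alpha>) (iter_deriv n \<alpha>)"
proof -
  have "diff_order n 0 (\<lambda>f. f)" by (simp add: diff_order.simps)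
  from diff_order_foldr_partial_deriv[OF this, of "Poly_Mapping.lookup \<alpha>" "[0..<n]"]
  show ?thesis
    using assms
    by (simp add: iter_deriv_def[abs_def] expo_deg_expos interv_sum_list_conv_sum_set_nat atLeast0LessThan)
qed

lemma diff_order_diffop_apply:
  assumes "\<delta> \<in> diffops n m"
  shows "diff_order n m (diffop_apply n \<delta>)"
  unfolding diffop_apply_def[abs_def]
  using assms by (intro diff_order_sum diff_order_mult) (auto simp: diffops_def intro: diff_order_iter_deriv)

lemma iter_deriv_polys: "f \<in> polys n \<Longrightarrow> iter_deriv n \<alpha> f \<in> polys n"
proof -
  have pow: "(partial_deriv i ^^ a) g \<in> polys n" if "g \<in> polys n" for i a g
    using that by (induction a) (auto intro: partial_deriv_polys)
  have "foldr (\<lambda>i. partial_deriv i ^^ Poly_Mapping.lookup \<alpha> i) xs f \<in> polys n"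
    if "f \<in> polys n" for xs
    using that by (induction xs) (auto intro: pow)
  then show "f \<in> polys n \<Longrightarrow> iter_deriv n \<alpha> f \<in> polys n"
    by (simp add: iter_deriv_def)
qed

lemma diffop_apply_polys: "\<delta> \<in> diffops n m \<Longrightarrow> f \<in> polys n \<Longrightarrow> diffop_apply n \<delta> f \<in> polys n"
  unfolding diffop_apply_def
  by (intro polys_sum polys_mult iter_deriv_polys) (auto simp: diffops_def)

text \<open>In \<open>E (X i * g) = (E (X i * g) - X i * E g) + X i * E g\<close> the first summand
  falls to the induction on the order, the second to the induction on the degree. As a consequence,
  on \<open>X i * g\<close> with \<open>g\<close> of degree one below the order, \<open>E\<close>
  agrees with its commutator applied to \<open>g\<close>.\<close>

lemma diff_order_vanish:
  "diff_order n k E \<Longrightarrow> d < k \<Longrightarrow> f \<in> homs n d \<Longrightarrow> E f = 0"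
proof (induction k arbitrary: E f d)
  case (Suc k)
  note lin = diff_order_linear[OF Suc.prems(1)]
  note IH = Suc.IH[OF diff_order_SucD(2)[OF Suc.prems(1)]]
  from Suc.prems(2,3) show ?case
  proof (induction d arbitrary: f)
    case 0
    then have "f = Co (Poly_Mapping.lookup f 0) * 1" using homs_0_Co by simp
    then show ?case using lin(2) diff_order_SucD(1)[OF Suc.prems(1)] by (metis mult_zero_right)
  next
    case (Suc d)
    from Suc.prems(2) show ?case
    proof (induction rule: homs_Suc_induct)
      case (X i g)
      have "E (X i * g) - X i * E g = 0"
        using Suc.prems(1) X by (intro IH) auto
      moreover have "E g = 0" using Suc X by auto
      ultimately show ?case by simp
    qed (use lin in auto)
  qed
qed simp

text \<open>The commutator is linear in the form, so the case of the variables suffices.\<close>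

lemma diff_order_commutator:
  assumes "diff_order n (Suc k) E" "l \<in> homs n 1"
  shows "diff_order n k (\<lambda>f. E (l * f) - l * E f)"
proof -
  note lin = diff_order_linear[OF assms(1)]
  have sum: "E (\<Sum>i\<in>I. g i) = (\<Sum>i\<in>I. E (g i))" for g and I :: "nat set"
    by (induction I rule: infinite_finite_induct) (auto simp: lin)
  have "E (l * f) - l * E f = (\<Sum>i<n. Co (lcoeff l i) * (E (X i * f) - X i * E f))" for f
    by (subst (1 2) homs_1_sum[OF assms(2)])
      (simp add: sum_distrib_right sum sum_subtractf right_diff_distrib mult.assoc lin)
  then show ?thesis
    using diff_order_SucD(2)[OF assms(1)] by (auto intro!: diff_order_sum diff_order_mult)
qed

text \<open>An operator without lower order terms is determined by its values in the degree of its
  order. The hypothesis passes to the commutators because \<open>E\<close> kills the degree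
  below.\<close>

lemma diff_order_dvd:
  "diff_order n k E \<Longrightarrow> (\<And>f. f \<in> homs n k \<Longrightarrow> l dvd E f) \<Longrightarrow> f \<in> polys n \<Longrightarrow> l dvd E f"
proof (induction k arbitrary: E f)
  case 0
  then show ?case by (metis diff_order_0D dvd_mult homs_1)
next
  case (Suc k)
  note lin = diff_order_linear[OF Suc.prems(1)]
  from Suc.prems(3) show ?case
  proof (induction rule: polys_induct)
    case (Co c)
    then show ?case using lin(2)[of c 1] diff_order_SucD(1)[OF Suc.prems(1)] by simp
  next
    case (add f g)
    then show ?case by (simp add: lin)
  next
    case (X i f)
    have "l dvd E (X i * g) - X i * E g" if "g \<in> homs n k" for g
    proof -
      have "E g = 0" using diff_order_vanish[OF Suc.prems(1)] that by blast
      moreover have "X i * g \<in> homs n (Suc k)"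
        using homs_mult[of "X i" n 1 g k] that X by (simp add: X_def)
      ultimately show ?thesis using Suc.prems(2) by simp
    qed
    then have "l dvd E (X i * f) - X i * E f"
      by (rule Suc.IH[OF diff_order_SucD(2)[OF Suc.prems(1) X(1)] _ X(2)])
    then have "l dvd (E (X i * f) - X i * E f) + X i * E f"
      using X by (intro dvd_add) auto
    then show ?case by simp
  qed
qed

text \<open>For a monomial \<open>f\<close> of degree \<open>k\<close>, the iterated commutator of
  \<open>E\<close> with the variables of \<open>f\<close> is multiplication by \<open>E f\<close>.
  Applied to \<open>P\<close> it is a combination of multiples of values \<open>E (P * q)\<close>,
  all divisible by \<open>l\<close>.\<close>

lemma diff_order_dvd_cancel:
  "diff_order n k E \<Longrightarrow> P \<in> polys n \<Longrightarrow> (\<And>q. q \<in> polys n \<Longrightarrow> l dvd E (P * q)) \<Longrightarrow>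
    f \<in> homs n k \<Longrightarrow> l dvd P * E f"
proof (induction k arbitrary: E f)
  case 0
  note E = diff_order_0D[OF 0(1)]
  have "l dvd E P" using 0(3)[of 1] by simp
  then show ?case using E[of P] E[of f] by (metis dvd_mult mult.left_commute)
next
  case (Suc k)
  note lin = diff_order_linear[OF Suc.prems(1)]
  from Suc.prems(4) show ?case
  proof (induction rule: homs_Suc_induct)
    case (X i g)
    have Xi: "X i \<in> polys n" using X by (simp add: X_def)
    have "l dvd E (X i * (P * q)) - X i * E (P * q)" if "q \<in> polys n" for q
      using that Suc.prems(3)[of "X i * q"] Suc.prems(3)[of q] Xi
      by (intro dvd_diff) (auto simp: mult.left_commute intro: polys_mult)
    then have "l dvd P * (E (X i * g) - X i * E g)"
      using X Suc.prems(2) by (intro Suc.IH[OF diff_order_SucD(2)[OF Suc.prems(1)]]) simp_all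
    moreover have "E g = 0" using diff_order_vanish[OF Suc.prems(1)] X by blast
    ultimately show ?case by simp
  qed (auto simp: lin distrib_left)
qed

subsection \<open>Action on polynomials of the same degree\<close>

text \<open>The falling factorial \<open>b (b - 1) ... (b - a + 1)\<close>. For \<open>b < a\<close>
  the factor at \<open>k = b\<close> is 0, in accordance with the vanishing derivative.\<close>

definition ffact :: "nat \<Rightarrow> nat \<Rightarrow> nat" where
  "ffact b a = (\<Prod>k<a. b - k)"

lemma ffact_eq_0: "b < a \<Longrightarrow> ffact b a = 0"
  by (auto simp: ffact_def)

lemma ffact_self: "ffact a a \<noteq> 0"
  by (auto simp: ffact_def)

lemma funpow_partial_deriv_single:
  "(partial_deriv i ^^ a) (Poly_Mapping.single \<beta> c) =
    Poly_Mapping.single (\<beta> - Poly_Mapping.single i a) (of_nat (ffact (Poly_Mapping.lookup \<beta> i) a) * c)"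
proof (induction a)
  case (Suc a)
  have "Poly_Mapping.single i a + unit_expo i = Poly_Mapping.single i (Suc a)"
    by (simp flip: single_add)
  then have "\<beta> - Poly_Mapping.single i a - unit_expo i = \<beta> - Poly_Mapping.single i (Suc a)"
    by (simp only: diff_diff_add)
  then show ?case
    by (simp add: Suc partial_deriv_single ffact_def lookup_minus mult_ac)
qed (simp add: ffact_def)

text \<open>Since the list is distinct, each variable still carries its original exponent when its
  turn comes.\<close>

lemma foldr_partial_deriv_single:
  assumes "distinct xs"
  shows "\<exists>\<gamma>. foldr (\<lambda>i. partial_deriv i ^^ a i) xs (Poly_Mapping.single \<beta> c) =
      Poly_Mapping.single \<gamma> (of_nat (\<Prod>i\<in>set xs. ffact (Poly_Mapping.lookup \<beta> i) (a i)) * c) \<and>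
    (\<forall>i. Poly_Mapping.lookup \<gamma> i = Poly_Mapping.lookup \<beta> i - (if i \<in> set xs then a i else 0))"
  using assms
proof (induction xs)
  case (Cons i xs)
  then obtain \<gamma> where \<gamma>: "foldr (\<lambda>i. partial_deriv i ^^ a i) xs (Poly_Mapping.single \<beta> c) =
      Poly_Mapping.single \<gamma> (of_nat (\<Prod>i\<in>set xs. ffact (Poly_Mapping.lookup \<beta> i) (a i)) * c)"
    "\<And>i. Poly_Mapping.lookup \<gamma> i = Poly_Mapping.lookup \<beta> i - (if i \<in> set xs then a i else 0)"
    by auto
  show ?case
    using Cons.prems
    by (intro exI[of _ "\<gamma> - Poly_Mapping.single i (a i)"])
      (auto simp: \<gamma> funpow_partial_deriv_single lookup_minus lookup_single when_def mult.assoc)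
qed auto

text \<open>As \<open>ffact a a\<close> is \<open>a!\<close>, this is the multi-index factorial of
  \<open>\<alpha>\<close>.\<close>

definition efact :: "nat \<Rightarrow> expo \<Rightarrow> complex" where
  "efact n \<alpha> = of_nat (\<Prod>i<n. ffact (Poly_Mapping.lookup \<alpha> i) (Poly_Mapping.lookup \<alpha> i))"

lemma efact_nonzero [simp]: "efact n \<alpha> \<noteq> 0"
  by (simp add: efact_def ffact_self)

lemma iter_deriv_single:
  assumes "\<alpha> \<in> expos n" "\<beta> \<in> expos n" "expo_deg \<alpha> = expo_deg \<beta>"
  shows "iter_deriv n \<alpha> (Poly_Mapping.single \<beta> c) = (if \<alpha> = \<beta> then Co (efact n \<alpha> * c) else 0)"
proof -
  obtain \<gamma> where \<gamma>: "iter_deriv n \<alpha> (Poly_Mapping.single \<beta> c) = Poly_Mapping.single \<gamma>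
      (of_nat (\<Prod>i<n. ffact (Poly_Mapping.lookup \<beta> i) (Poly_Mapping.lookup \<alpha> i)) * c)"
    "\<And>i. Poly_Mapping.lookup \<gamma> i =
      Poly_Mapping.lookup \<beta> i - (if i < n then Poly_Mapping.lookup \<alpha> i else 0)"
    using foldr_partial_deriv_single[of "[0..<n]" "Poly_Mapping.lookup \<alpha>" \<beta> c]
    by (auto simp: iter_deriv_def atLeast0LessThan)
  show ?thesis
  proof (cases "\<alpha> = \<beta>")
    case True
    have "\<gamma> = 0"
      using assms(1) by (intro poly_mapping_eqI) (auto simp: \<gamma> True expos_def in_keys_iff)
    then show ?thesis using \<gamma>(1) by (simp add: True efact_def)
  next
    case False
    \<comment> \<open>If \<open>\<alpha> \<le> \<beta>\<close> held componentwise, equality of the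
      degrees would force \<open>\<alpha> = \<beta>\<close>.\<close>
    have "\<exists>i<n. Poly_Mapping.lookup \<beta> i < Poly_Mapping.lookup \<alpha> i"
    proof (rule ccontr)
      assume "\<not> ?thesis"
      then have le: "\<And>i. i \<in> {..<n} \<Longrightarrow> Poly_Mapping.lookup \<alpha> i \<le> Poly_Mapping.lookup \<beta> i"
        by (metis lessThan_iff not_less)
      have "(\<Sum>i<n. Poly_Mapping.lookup \<alpha> i) = (\<Sum>i<n. Poly_Mapping.lookup \<beta> i)"
        using assms by (simp add: expo_deg_expos)
      from sum_mono_inv[OF this le]
      have "Poly_Mapping.lookup \<alpha> i = Poly_Mapping.lookup \<beta> i" if "i < n" for i
        using that by simp
      moreover have "Poly_Mapping.lookup \<alpha> i = Poly_Mapping.lookup \<beta> i" if "\<not> i < n" for i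
        using that assms(1,2) unfolding expos_def
        by (metis in_keys_iff lessThan_iff mem_Collect_eq subsetD)
      ultimately show False using False by (metis poly_mapping_eqI)
    qed
    then have "(\<Prod>i<n. ffact (Poly_Mapping.lookup \<beta> i) (Poly_Mapping.lookup \<alpha> i)) = 0"
      by (intro prod_zero) (auto intro: ffact_eq_0)
    then show ?thesis unfolding \<gamma>(1) using False
      by (simp only: of_nat_0 mult_zero_left single_zero if_False)
  qed
qed

text \<open>Makes the coefficients of an operator visible in its action: in degree \<open>m\<close>
  only the term with the same exponent survives.\<close>

lemma diffop_apply_single:
  assumes "\<delta> \<in> diffops n m" "\<beta> \<in> expos n" "expo_deg \<beta> = m"
  shows "diffop_apply n \<delta> (Poly_Mapping.single \<beta> c) = Co (efact n \<beta> * c) * Poly_Mapping.lookup \<delta> \<beta>"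
proof -
  have "diffop_apply n \<delta> (Poly_Mapping.single \<beta> c) =
      (\<Sum>\<alpha>\<in>Poly_Mapping.keys \<delta>. if \<alpha> = \<beta> then Co (efact n \<beta> * c) * Poly_Mapping.lookup \<delta> \<beta> else 0)"
    unfolding diffop_apply_def using assms
    by (intro sum.cong) (auto simp: diffops_def iter_deriv_single)
  then show ?thesis by (simp add: in_keys_iff)
qed

section \<open>Generic families of linear forms\<close>

definition zeros :: "nat \<Rightarrow> (nat \<Rightarrow> cpoly) \<Rightarrow> nat set \<Rightarrow> point set" where
  "zeros n l B = {v \<in> points n. \<forall>i\<in>B. poly_eval (l i) v = 0}"

text \<open>An indexed family, so that forms can be appended one at a time. For \<open>n = 1\<close>
  it allows proportional forms, since sets of two indices are then not constrained.\<close>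

definition generic_forms :: "nat \<Rightarrow> (nat \<Rightarrow> cpoly) \<Rightarrow> nat \<Rightarrow> bool" where
  "generic_forms n l R \<longleftrightarrow> (\<forall>i<R. l i \<in> homs n 1) \<and>
     (\<forall>B\<subseteq>{..<R}. card B \<le> n \<longrightarrow> pt.dim (zeros n l B) + card B = n)"

section \<open>Dimensions of subspaces of the space of points\<close>

lemma poly_eval_linear_0: "l \<in> homs n 1 \<Longrightarrow> poly_eval l 0 = 0"
  by (simp add: poly_eval_linear_form)

lemma subspace_zeros:
  assumes "\<And>i. i \<in> B \<Longrightarrow> l i \<in> homs n 1"
  shows "pt.subspace (zeros n l B)"
proof (rule pt.subspaceI)
  show "0 \<in> zeros n l B"
    using poly_eval_linear_0[OF assms] by (auto simp: zeros_def points_def)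
next
  fix v w assume "v \<in> zeros n l B" "w \<in> zeros n l B"
  then show "v + w \<in> zeros n l B"
    using Poly_Mapping.keys_add[of v w] poly_eval_linear_add[OF assms]
    by (auto simp: zeros_def points_def)
next
  fix c v assume v: "v \<in> zeros n l B"
  have "Poly_Mapping.keys (point_scale c v) \<subseteq> Poly_Mapping.keys v"
    by (auto simp: in_keys_iff lookup_point_scale)
  then show "point_scale c v \<in> zeros n l B"
    using v poly_eval_linear_scale[OF assms] by (auto simp: zeros_def points_def)
qed

lemma points_finite_span:
  shows "finite ((\<lambda>i. Poly_Mapping.single i 1) ` {..<n} :: point set)"
    and "points n \<subseteq> pt.span ((\<lambda>i. Poly_Mapping.single i 1) ` {..<n})"
proof -
  show "points n \<subseteq> pt.span ((\<lambda>i. Poly_Mapping.single i 1) ` {..<n})"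
  proof
    fix v assume v: "v \<in> points n"
    have "v = (\<Sum>i<n. point_scale (Poly_Mapping.lookup v i) (Poly_Mapping.single i 1))"
    proof (rule poly_mapping_eqI)
      fix k
      have "(\<Sum>i<n. Poly_Mapping.lookup v i * (if i = k then 1 else 0)) =
          (\<Sum>i<n. if i = k then Poly_Mapping.lookup v k else 0)"
        by (intro sum.cong) auto
      also have "\<dots> = Poly_Mapping.lookup v k"
        using v by (auto simp: points_def in_keys_iff subset_iff)
      finally show "Poly_Mapping.lookup v k = Poly_Mapping.lookup
          (\<Sum>i<n. point_scale (Poly_Mapping.lookup v i) (Poly_Mapping.single i 1)) k"
        by (simp add: lookup_sum lookup_point_scale lookup_single when_def)
    qed
    then show "v \<in> pt.span ((\<lambda>i. Poly_Mapping.single i 1) ` {..<n})"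
      by (metis (no_types, lifting) imageI pt.span_base pt.span_scale pt.span_sum)
  qed
qed simp

lemma independent_points_finite: "pt.independent B \<Longrightarrow> B \<subseteq> points n \<Longrightarrow> finite B"
  using pt.independent_span_bound[OF points_finite_span(1)[of n], of B] points_finite_span(2)[of n] by blast

lemma dim_pos_nonzero:
  assumes "pt.dim V > 0"
  obtains v where "v \<in> V" "v \<noteq> 0"
proof -
  obtain B where B: "B \<subseteq> V" "pt.independent B" "card B = pt.dim V"
    using pt.basis_exists by metis
  then obtain v where "v \<in> B" using assms by (cases "B = {}") auto
  with B that show thesis using pt.dependent_zero by (metis subsetD)
qed

text \<open>The inclusion in \<open>points n\<close> guarantees a finite basis; the value 0 of
  \<open>dim\<close> could otherwise stand for infinite dimension.\<close>

lemma dim_0_trivial: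
  assumes "pt.dim V = 0" "V \<subseteq> points n" "v \<in> V"
  shows "v = 0"
proof -
  obtain B where B: "B \<subseteq> V" "pt.independent B" "V \<subseteq> pt.span B" "card B = pt.dim V"
    by (rule pt.basis_exists[of V])
  then have "B = {}" using independent_points_finite[of B n] assms by auto
  then show ?thesis using B assms by auto
qed

lemma dim_hyperplane_section:
  assumes V: "pt.subspace V" "V \<subseteq> points n" and l: "l \<in> homs n 1"
    and u: "u \<in> V" "poly_eval l u \<noteq> 0"
  shows "pt.dim V = Suc (pt.dim {v \<in> V. poly_eval l v = 0})"
proof -
  let ?W = "{v \<in> V. poly_eval l v = 0}"
  have W: "pt.subspace ?W"
    using V(1) unfolding pt.subspace_def
    by (auto simp: poly_eval_linear_add[OF l] poly_eval_linear_scale[OF l] poly_eval_linear_0[OF l])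
  obtain B where B: "B \<subseteq> ?W" "pt.independent B" "?W \<subseteq> pt.span B" "card B = pt.dim ?W"
    by (rule pt.basis_exists[of ?W])
  have fin: "finite B" using B V by (intro independent_points_finite[of B n]) blast+
  have spanB: "pt.span B \<subseteq> ?W" using B(1) W by (rule pt.span_minimal)
  then have u': "u \<notin> pt.span B" using u by auto
  have "pt.independent (insert u B)" using u' B by (simp add: pt.independent_insert)
  moreover have "insert u B \<subseteq> V" using u B by auto
  moreover have "V \<subseteq> pt.span (insert u B)"
  proof
    fix v assume v: "v \<in> V"
    define c where "c = poly_eval l v / poly_eval l u"
    have "v - point_scale c u \<in> V" using V(1) v u by (intro pt.subspace_diff pt.subspace_scale)
    moreover have "poly_eval l v = poly_eval l (v - point_scale c u) + poly_eval l (point_scale c u)"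
      using poly_eval_linear_add[OF l, of "v - point_scale c u" "point_scale c u"] by simp
    then have "poly_eval l (v - point_scale c u) = 0"
      using u by (simp add: poly_eval_linear_scale[OF l] c_def)
    ultimately have "v - point_scale c u \<in> pt.span B" using B by blast
    then show "v \<in> pt.span (insert u B)" by (auto simp: pt.span_insert)
  qed
  moreover have "card (insert u B) = Suc (pt.dim ?W)"
    using fin u' B by (metis card_insert_disjoint pt.span_base)
  ultimately show ?thesis by (metis pt.dim_unique)
qed

lemma independent_spans_points:
  assumes B: "pt.independent B" "B \<subseteq> points n" and card: "card B = pt.dim (points n)"
  shows "points n \<subseteq> pt.span B"
proof (rule ccontr)
  assume "\<not> ?thesis"
  then obtain v where v: "v \<in> points n" "v \<notin> pt.span B" by auto
  obtain D where D: "D \<subseteq> points n" "pt.independent D" "points n \<subseteq> pt.span D" "card D = pt.dim (points n)"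
    by (rule pt.basis_exists[of "points n"])
  have "pt.independent (insert v B)" using B v by (simp add: pt.independent_insert)
  then have "card (insert v B) \<le> card D"
    using pt.independent_span_bound[of D "insert v B"] independent_points_finite[OF D(2,1)] B D v by blast
  moreover have "v \<notin> B" using v pt.span_base by blast
  ultimately show False using independent_points_finite[OF B] card D(4) by simp
qed

text \<open>A form that avoids the old points is perturbed by a multiple of a variable that is
  nonzero at the new point; only finitely many multiples are excluded.\<close>

lemma linear_form_avoiding:
  assumes "finite Y" "Y \<subseteq> points n" "0 \<notin> Y"
  shows "\<exists>w \<in> homs n 1. \<forall>y\<in>Y. poly_eval w y \<noteq> 0"
  using assms
proof (induction Y rule: finite_induct)
  case empty
  then show ?case by (intro bexI[of _ 0]) auto
next
  case (insert y Y)
  then obtain w where w: "w \<in> homs n 1" "\<forall>y\<in>Y. poly_eval w y \<noteq> 0" by auto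
  obtain i where i: "i < n" "Poly_Mapping.lookup y i \<noteq> 0"
    using insert.prems by (auto simp: points_def)
      (metis in_keys_iff lessThan_iff lookup_zero poly_mapping_eqI subsetD)
  have Xi: "X i \<in> homs n 1" using i by (simp add: X_def)
  \<comment> \<open>The roots in \<open>t\<close> of the perturbed form at the given points. A point
    with coordinate 0 at \<open>i\<close> differs from \<open>y\<close> and keeps the nonzero value
    of \<open>w\<close>.\<close>
  define bad where "bad = (\<lambda>z. - poly_eval w z / Poly_Mapping.lookup z i) ` insert y Y"
  have "finite bad" using insert.hyps by (simp add: bad_def)
  then have "finite (insert 0 bad)" by simp
  then obtain t where t: "t \<notin> insert 0 bad"
    using ex_new_if_finite infinite_UNIV_char_0 by blast
  have ev: "poly_eval (w + Co t * X i) z = poly_eval w z + t * Poly_Mapping.lookup z i" for z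
    by (simp add: poly_eval_psub eval.psub_add eval.psub_Co_mult)
  have "poly_eval (w + Co t * X i) z \<noteq> 0" if z: "z \<in> insert y Y" for z
  proof (cases "Poly_Mapping.lookup z i = 0")
    case True
    then show ?thesis using z i w by (auto simp: ev)
  next
    case False
    show ?thesis
    proof
      assume "poly_eval (w + Co t * X i) z = 0"
      then have "t = - poly_eval w z / Poly_Mapping.lookup z i"
        using False unfolding ev by (simp add: field_simps add_eq_0_iff)
      then show False using t z by (auto simp: bad_def)
    qed
  qed
  then show ?case using w(1) Xi by (intro bexI[of _ "w + Co t * X i"]) (auto intro: homs_add homs_Co_mult)
qed

section \<open>Completion and spanning properties of generic families\<close>

lemma generic_formsD:
  assumes "generic_forms n l R"
  shows "i < R \<Longrightarrow> l i \<in> homs n 1"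
    and "B \<subseteq> {..<R} \<Longrightarrow> card B \<le> n \<Longrightarrow> pt.dim (zeros n l B) + card B = n"
  using assms unfolding generic_forms_def by blast+

lemma zeros_cong: "(\<And>i. i \<in> B \<Longrightarrow> l i = l' i) \<Longrightarrow> zeros n l B = zeros n l' B"
  by (auto simp: zeros_def)

text \<open>One nonzero point is chosen on each intersection of fewer than \<open>n\<close> old
  hyperplanes. A form that vanishes at none of them lowers the dimension of every such intersection
  by one.\<close>

lemma generic_forms_extend_1:
  assumes gen: "generic_forms n l R"
  shows "\<exists>w. generic_forms n (l(R := w)) (Suc R)"
proof -
  let ?\<B> = "{B. B \<subseteq> {..<R} \<and> card B < n}"
  have "\<exists>y. y \<in> zeros n l B \<and> y \<noteq> 0" if "B \<in> ?\<B>" for B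
  proof -
    have "pt.dim (zeros n l B) > 0" using generic_formsD(2)[OF gen, of B] that by auto
    then show ?thesis using dim_pos_nonzero by metis
  qed
  then obtain y where y: "\<And>B. B \<in> ?\<B> \<Longrightarrow> y B \<in> zeros n l B \<and> y B \<noteq> 0" by metis
  have "finite (y ` ?\<B>)" by simp
  moreover have "y ` ?\<B> \<subseteq> points n" "0 \<notin> y ` ?\<B>" using y by (auto simp: zeros_def)
  ultimately obtain w where w: "w \<in> homs n 1" "\<And>B. B \<in> ?\<B> \<Longrightarrow> poly_eval w (y B) \<noteq> 0"
    using linear_form_avoiding[of "y ` ?\<B>" n] by auto
  define l' where "l' = l(R := w)"
  have dim: "pt.dim (zeros n l' B) + card B = n" if B: "B \<subseteq> {..<Suc R}" "card B \<le> n" for B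
  proof (cases "R \<in> B")
    case False
    then have "B \<subseteq> {..<R}" using B by (auto simp: less_Suc_eq)
    moreover have "zeros n l' B = zeros n l B"
      using False by (intro zeros_cong) (auto simp: l'_def)
    ultimately show ?thesis using generic_formsD(2)[OF gen, of B] B(2) by simp
  next
    case True
    define C where "C = B - {R}"
    have finB: "finite B" using B(1) finite_subset by blast
    have cB: "card B = Suc (card C)" using card_Suc_Diff1[OF finB True] by (simp add: C_def)
    have "C \<subseteq> {..<R}" using B(1) unfolding C_def lessThan_Suc by blast
    then have C: "C \<in> ?\<B>" using B(2) cB by simp
    have "B = insert R C" using True by (auto simp: C_def)
    then have zC: "zeros n l' B = {v \<in> zeros n l C. poly_eval w v = 0}"
      unfolding zeros_def l'_def C_def by auto
    have "pt.subspace (zeros n l C)"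
      using generic_formsD(1)[OF gen] C by (intro subspace_zeros) auto
    then have "pt.dim (zeros n l C) = Suc (pt.dim (zeros n l' B))"
      unfolding zC using y[OF C] w C by (intro dim_hyperplane_section[of _ n]) (auto simp: zeros_def)
    moreover have "pt.dim (zeros n l C) + card C = n"
      using generic_formsD(2)[OF gen, of C] C by auto
    ultimately show ?thesis using cB by simp
  qed
  have "generic_forms n l' (Suc R)"
    using gen w dim by (auto simp: generic_forms_def l'_def less_Suc_eq)
  then show ?thesis unfolding l'_def by blast
qed

lemma generic_forms_extend:
  assumes "generic_forms n l r" "r \<le> R"
  shows "\<exists>l'. (\<forall>i<r. l' i = l i) \<and> generic_forms n l' R"
  using assms(2)
proof (induction R rule: dec_induct)
  case base
  then show ?case using assms by auto
next
  case (step R)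
  then obtain l' where l': "\<forall>i<r. l' i = l i" "generic_forms n l' R" by auto
  then obtain w where "generic_forms n (l'(R := w)) (Suc R)" using generic_forms_extend_1 by blast
  moreover have "\<forall>i<r. (l'(R := w)) i = l i" using l'(1) step(1) by simp
  ultimately show ?case by blast
qed

text \<open>The forms in \<open>B\<close> cut out a line. If another form vanished at its direction,
  \<open>n\<close> generic forms would have a common zero other than the origin.\<close>

lemma generic_forms_dual_point:
  assumes gen: "generic_forms n l R" and B: "B \<subseteq> {..<R}" "Suc (card B) = n"
  obtains v where "v \<in> points n" "\<And>i. i \<in> B \<Longrightarrow> poly_eval (l i) v = 0"
    "\<And>i. i < R \<Longrightarrow> i \<notin> B \<Longrightarrow> poly_eval (l i) v \<noteq> 0"
proof -
  have "pt.dim (zeros n l B) > 0" using generic_formsD(2)[OF gen B(1)] B(2) by simp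
  then obtain v where v: "v \<in> zeros n l B" "v \<noteq> 0" using dim_pos_nonzero by metis
  have "poly_eval (l i) v \<noteq> 0" if i: "i < R" "i \<notin> B" for i
  proof
    assume "poly_eval (l i) v = 0"
    then have "v \<in> zeros n l (insert i B)" using v by (auto simp: zeros_def)
    moreover have "card (insert i B) = n" using B i finite_subset[OF B(1)] by simp
    then have "pt.dim (zeros n l (insert i B)) = 0"
      using generic_formsD(2)[OF gen, of "insert i B"] B i by simp
    ultimately show False using dim_0_trivial[of "zeros n l (insert i B)" n v] v by (auto simp: zeros_def)
  qed
  then show thesis using that v by (auto simp: zeros_def)
qed

text \<open>The \<open>n\<close> points dual to the forms indexed by \<open>B\<close> span the whole space, so a linear form is
  determined by its values at them.\<close>

lemma generic_forms_span:
  assumes gen: "generic_forms n l R" and B: "B \<subseteq> {..<R}" "card B = n" and f: "f \<in> homs n 1"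
  shows "\<exists>t. f = (\<Sum>k\<in>B. Co (t k) * l k)"
proof -
  have finB: "finite B" using B(1) finite_subset by blast
  have l: "l k \<in> homs n 1" if "k \<in> B" for k using gen B that by (auto simp: generic_forms_def)
  have "\<exists>v. v \<in> points n \<and> (\<forall>i\<in>B - {k}. poly_eval (l i) v = 0) \<and> poly_eval (l k) v \<noteq> 0"
    if "k \<in> B" for k
  proof -
    have "Suc (card (B - {k})) = n" using card_Suc_Diff1[OF finB that] B(2) by simp
    moreover have "B - {k} \<subseteq> {..<R}" "k < R" using B that by auto
    ultimately show ?thesis using generic_forms_dual_point[OF gen, of "B - {k}"] that
      by (metis DiffE singletonI)
  qed
  then obtain v where v: "\<And>k. k \<in> B \<Longrightarrow> v k \<in> points n"
    "\<And>k i. k \<in> B \<Longrightarrow> i \<in> B \<Longrightarrow> i \<noteq> k \<Longrightarrow> poly_eval (l i) (v k) = 0"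
    "\<And>k. k \<in> B \<Longrightarrow> poly_eval (l k) (v k) \<noteq> 0"
    by (metis DiffI singletonD)
  \<comment> \<open>Among the forms of \<open>B\<close> only \<open>l k\<close> is nonzero at
    \<open>v k\<close>, so the sum is the interpolant of \<open>f\<close> at the dual points and
    \<open>g\<close> vanishes at all of them.\<close>
  define g where "g = f - (\<Sum>k\<in>B. Co (poly_eval f (v k) / poly_eval (l k) (v k)) * l k)"
  have g: "g \<in> homs n 1"
  proof -
    have "g = f + Co (-1) * (\<Sum>k\<in>B. Co (poly_eval f (v k) / poly_eval (l k) (v k)) * l k)"
      by (simp add: g_def single_uminus)
    then show ?thesis using f l by (auto intro!: homs_add homs_Co_mult homs_sum)
  qed
  have ev: "poly_eval g w = poly_eval f w -
      (\<Sum>k\<in>B. poly_eval f (v k) / poly_eval (l k) (v k) * poly_eval (l k) w)" for w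
  proof -
    have "poly_eval (g + (\<Sum>k\<in>B. Co (poly_eval f (v k) / poly_eval (l k) (v k)) * l k)) w = poly_eval f w"
      by (simp add: g_def)
    then show ?thesis
      by (simp add: poly_eval_psub eval.psub_add eval.psub_sum eval.psub_Co_mult eq_diff_eq)
  qed
  have g0: "poly_eval g (v j) = 0" if j: "j \<in> B" for j
  proof -
    have "(\<Sum>k\<in>B. poly_eval f (v k) / poly_eval (l k) (v k) * poly_eval (l k) (v j)) =
        (\<Sum>k\<in>B. if k = j then poly_eval f (v j) else 0)"
      using v j by (intro sum.cong) auto
    then show ?thesis using finB j by (simp add: ev)
  qed
  have "inj_on v B" using v by (metis inj_onI)
  have "pt.independent (v ` B)"
  proof (rule pt.independent_if_scalars_zero)
    fix c x assume sum0: "(\<Sum>x\<in>v ` B. point_scale (c x) x) = 0" and "x \<in> v ` B"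
    then obtain j where j: "j \<in> B" "x = v j" by auto
    \<comment> \<open>Applying \<open>l j\<close> to a vanishing combination isolates the
      coefficient of \<open>v j\<close>.\<close>
    have lin: "poly_eval (l j) (\<Sum>k\<in>A. point_scale (c (v k)) (v k)) = (\<Sum>k\<in>A. c (v k) * poly_eval (l j) (v k))" for A
      using l[OF j(1)] by (induction A rule: infinite_finite_induct)
        (auto simp: poly_eval_linear_add[OF l[OF j(1)]] poly_eval_linear_scale[OF l[OF j(1)]]
          poly_eval_linear_0[OF l[OF j(1)]])
    have "0 = (\<Sum>k\<in>B. c (v k) * poly_eval (l j) (v k))"
      using sum0 lin[of B] poly_eval_linear_0[OF l[OF j(1)]] by (simp add: sum.reindex[OF \<open>inj_on v B\<close>])
    also have "\<dots> = (\<Sum>k\<in>B. if k = j then c x * poly_eval (l j) (v j) else 0)"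
      using v j by (intro sum.cong) auto
    finally show "c x = 0" using finB j v by auto
  qed (use finB in simp)
  moreover have "card (v ` B) = n" using \<open>inj_on v B\<close> B by (simp add: card_image)
  moreover have dim: "pt.dim (points n) = n"
    using generic_formsD(2)[OF gen, of "{}"] by (simp add: zeros_def)
  moreover have "v ` B \<subseteq> points n" using v by auto
  ultimately have "points n \<subseteq> pt.span (v ` B)"
    by (simp add: independent_spans_points)
  moreover have "pt.span (v ` B) \<subseteq> {w. poly_eval g w = 0}"
    using g0 by (intro pt.span_minimal)
      (auto simp: pt.subspace_def poly_eval_linear_add[OF g] poly_eval_linear_scale[OF g]
        poly_eval_linear_0[OF g])
  ultimately have "poly_eval g w = 0" if "w \<in> points n" for w using that by auto
  then have "poly_eval g (Poly_Mapping.single i 1) = 0" if "i < n" for i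
    using that by (auto simp: points_def)
  then have "lcoeff g i = 0" if "i < n" for i
    using that by (simp add: poly_eval_linear_form[OF g] lookup_single when_def if_distrib cong: if_cong)
  then have "g = 0" using homs_1_sum[OF g] by simp
  then show ?thesis
    by (intro exI[of _ "\<lambda>k. poly_eval f (v k) / poly_eval (l k) (v k)"]) (simp add: g_def)
qed

text \<open>Any \<open>n\<close> forms of \<open>K\<close> span the linear forms, so one factor
  \<open>l k\<close> with \<open>k \<in> K\<close> can be split off. The predicate \<open>P\<close>
  stands for a linear condition to be checked on products only.\<close>

lemma generic_products_span:
  assumes gen: "generic_forms n l R" and n: "n > 0"
    and K: "K \<subseteq> {..<R}" "Suc (card K) = d + n" and f: "f \<in> homs n d"
    and add: "\<And>f g. P f \<Longrightarrow> P g \<Longrightarrow> P (f + g)" and scale: "\<And>c f. P f \<Longrightarrow> P (Co c * f)"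
    and prod: "\<And>J. J \<subseteq> K \<Longrightarrow> card J = d \<Longrightarrow> P (\<Prod>i\<in>J. l i)"
  shows "P f"
  using K f add scale prod
proof (induction d arbitrary: K f P)
  case 0
  have "P 1" using 0(6)[of "{}"] by simp
  then show ?case using 0(5) homs_0_Co[OF 0(3)] by (metis mult.right_neutral)
next
  case (Suc d)
  have finK: "finite K" using Suc.prems(1) finite_subset by blast
  obtain B where B: "B \<subseteq> K" "card B = n"
    using Suc.prems(2) obtain_subset_with_card_n[of n K] by auto
  \<comment> \<open>Removing \<open>k\<close> from \<open>K\<close> keeps the products squarefree,
    and the count still fits: degree and number of forms both drop by one.\<close>
  have lP: "P (l k * g)" if k: "k \<in> B" and g: "g \<in> homs n d" for k g
  proof (rule Suc.IH[of "K - {k}" g "\<lambda>g. P (l k * g)"])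
    show "Suc (card (K - {k})) = d + n"
      using finK k B Suc.prems(2) by (subst card_Suc_Diff1) auto
    show "P (l k * prod l J)" if "J \<subseteq> K - {k}" "card J = d" for J
    proof -
      have "finite J" "k \<notin> J" using that finK finite_subset by auto
      moreover have "insert k J \<subseteq> K" using that k B by auto
      ultimately show ?thesis using Suc.prems(6)[of "insert k J"] that by simp
    qed
    show "P (l k * (Co c * h))" if "P (l k * h)" for c h
    proof -
      have "P (Co c * (l k * h))" using that by (rule Suc.prems(5))
      then show ?thesis by (simp only: mult.left_commute)
    qed
  qed (use Suc.prems g in \<open>auto simp: distrib_left\<close>)
  from Suc.prems(3) show ?case
  proof (induction rule: homs_Suc_induct)
    case zero
    \<comment> \<open>\<open>P 0\<close> is not assumed; it comes from scaling a product by 0. Such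
      a product exists because \<open>n > 0\<close> gives \<open>card K \<ge> Suc d\<close>.\<close>
    obtain J where "J \<subseteq> K" "card J = Suc d"
      using n Suc.prems(2) obtain_subset_with_card_n[of "Suc d" K] by auto
    then have "P (Co 0 * prod l J)" using Suc.prems by blast
    then show ?case by simp
  next
    case (X i g)
    obtain t where t: "X i = (\<Sum>k\<in>B. Co (t k) * l k)"
      using generic_forms_span[OF gen, of B "X i"] B Suc.prems(1) X by (auto simp: X_def)
    have "P (\<Sum>k\<in>C. Co (t k) * (l k * g))" if "finite C" "C \<noteq> {}" "C \<subseteq> B" for C
      using that
    proof (induction C rule: finite_ne_induct)
      case (insert k C)
      then have "P (Co (t k) * (l k * g))" using lP X Suc.prems(5) by auto
      with insert show ?case using Suc.prems(4) by auto
    qed (use lP X Suc.prems(5) in auto)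
    then have "P (\<Sum>k\<in>B. Co (t k) * (l k * g))"
      using B n finK finite_subset[of B K] by fastforce
    then show ?case by (simp add: t sum_distrib_right mult.assoc)
  qed (use Suc.prems in auto)
qed

lemma generic_forms_nonzero:
  assumes gen: "generic_forms n l R" and n: "n > 0" and i: "i < R"
  shows "l i \<noteq> 0"
proof
  assume "l i = 0"
  then have "zeros n l {i} = zeros n l {}" by (auto simp: zeros_def poly_eval_def)
  then show False
    using generic_formsD(2)[OF gen, of "{i}"] generic_formsD(2)[OF gen, of "{}"] n i by simp
qed

section \<open>Linearity in the operator\<close>

lemma diffop_apply_superset:
  assumes "finite B" "Poly_Mapping.keys \<delta> \<subseteq> B"
  shows "diffop_apply n \<delta> f = (\<Sum>\<alpha>\<in>B. Poly_Mapping.lookup \<delta> \<alpha> * iter_deriv n \<alpha> f)"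
  unfolding diffop_apply_def
  using assms by (intro sum.mono_neutral_left) (auto simp: in_keys_iff)

lemma diffop_apply_add_op: "diffop_apply n (\<delta> + \<epsilon>) f = diffop_apply n \<delta> f + diffop_apply n \<epsilon> f"
proof -
  let ?B = "Poly_Mapping.keys \<delta> \<union> Poly_Mapping.keys \<epsilon>"
  have "Poly_Mapping.keys (\<delta> + \<epsilon>) \<subseteq> ?B" by (rule Poly_Mapping.keys_add)
  then show ?thesis
    by (simp add: diffop_apply_superset[of ?B] lookup_add distrib_right sum.distrib)
qed

lemma keys_diffop_scale: "Poly_Mapping.keys (diffop_scale c \<delta>) \<subseteq> Poly_Mapping.keys \<delta>"
  by (auto simp: in_keys_iff lookup_diffop_scale)

lemma diffop_apply_scale_op: "diffop_apply n (diffop_scale c \<delta>) f = Co c * diffop_apply n \<delta> f"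
  by (simp add: diffop_apply_superset[of "Poly_Mapping.keys \<delta>"] keys_diffop_scale
      lookup_diffop_scale mult.assoc sum_distrib_left)

lemma diffop_apply_0_op [simp]: "diffop_apply n 0 f = 0"
  by (simp add: diffop_apply_def)

lemma diffop_apply_sum_op: "diffop_apply n (\<Sum>i\<in>I. \<delta> i) f = (\<Sum>i\<in>I. diffop_apply n (\<delta> i) f)"
  by (induction I rule: infinite_finite_induct) (simp_all add: diffop_apply_add_op)

lemma diffops_0 [simp]: "0 \<in> diffops n m"
  by (simp add: diffops_def)

lemma diffops_add: "\<delta> \<in> diffops n m \<Longrightarrow> \<epsilon> \<in> diffops n m \<Longrightarrow> \<delta> + \<epsilon> \<in> diffops n m"
  using Poly_Mapping.keys_add[of \<delta> \<epsilon>] by (auto simp: diffops_def lookup_add intro: polys_add)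

lemma diffops_scale: "\<delta> \<in> diffops n m \<Longrightarrow> diffop_scale c \<delta> \<in> diffops n m"
  using keys_diffop_scale[of c \<delta>] by (auto simp: diffops_def lookup_diffop_scale intro: polys_mult)

lemma diffops_sum: "(\<And>i. i \<in> I \<Longrightarrow> \<delta> i \<in> diffops n m) \<Longrightarrow> (\<Sum>i\<in>I. \<delta> i) \<in> diffops n m"
  by (induction I rule: infinite_finite_induct) (auto intro: diffops_add)

text \<open>Injectivity of the family comes for free: two equal members would satisfy the relation
  with coefficients 1 and -1.\<close>

lemma (in vector_space) dim_eq_card_family:
  assumes I: "finite I" and V: "\<And>i. i \<in> I \<Longrightarrow> g i \<in> V"
    and ind: "\<And>t i. (\<Sum>i\<in>I. t i *s g i) = 0 \<Longrightarrow> i \<in> I \<Longrightarrow> t i = 0"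
    and span: "\<And>x. x \<in> V \<Longrightarrow> \<exists>t. x = (\<Sum>i\<in>I. t i *s g i)"
  shows "dim V = card I"
proof -
  have inj: "inj_on g I"
  proof (rule inj_onI, rule ccontr)
    fix i j assume ij: "i \<in> I" "j \<in> I" "g i = g j" "i \<noteq> j"
    define t :: "'c \<Rightarrow> 'a" where "t k = (if k = i then 1 else if k = j then -1 else 0)" for k
    have "(\<Sum>k\<in>I. t k *s g k) = (\<Sum>k\<in>{i, j}. t k *s g k)"
      using I ij by (intro sum.mono_neutral_right) (auto simp: t_def)
    also have "\<dots> = 0" using ij by (simp add: t_def)
    finally show False using ind[of t i] ij by (simp add: t_def)
  qed
  have "independent (g ` I)"
  proof (rule independent_if_scalars_zero)
    fix f x assume "(\<Sum>x\<in>g ` I. f x *s x) = 0" "x \<in> g ` I"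
    then show "f x = 0" using ind[of "\<lambda>i. f (g i)"] by (auto simp: sum.reindex[OF inj])
  qed (use I in simp)
  moreover have "V \<subseteq> local.span (g ` I)"
  proof
    fix x assume "x \<in> V"
    then obtain t where "x = (\<Sum>i\<in>I. t i *s g i)" using span by blast
    then show "x \<in> local.span (g ` I)" by (simp add: span_sum span_scale span_base)
  qed
  moreover have "g ` I \<subseteq> V" using V by auto
  ultimately show ?thesis using card_image[OF inj] by (intro dim_unique)
qed

text \<open>The first \<open>r\<close> forms define the arrangement; the others only complete it to \<open>m + n - 1\<close> generic
  forms and impose no condition.\<close>

locale generic_setting =
  fixes n m r R :: nat and l :: "nat \<Rightarrow> cpoly"
  assumes n: "n > 0" and m: "m > 0" and gen: "generic_forms n l R" and R: "Suc R = m + n"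
    and r: "r \<le> R" and not_dvd: "\<And>i j. i < r \<Longrightarrow> j < r \<Longrightarrow> i \<noteq> j \<Longrightarrow> \<not> l i dvd l j"
begin

definition "\<J> = {J. J \<subseteq> {..<R} \<and> card J = m}"

definition "p = (\<Prod>i<r. l i)"

definition "L J = (\<Prod>i\<in>J \<inter> {..<r}. l i)"

lemma l_homs: "i < R \<Longrightarrow> l i \<in> homs n 1"
  using generic_formsD(1)[OF gen] .

lemma l_polys: "i < R \<Longrightarrow> l i \<in> polys n"
  using l_homs homs_polys by blast

lemma l_nonzero: "i < R \<Longrightarrow> l i \<noteq> 0"
  using generic_forms_nonzero[OF gen n] .

lemma finite_\<J>: "finite \<J>"
  unfolding \<J>_def by (rule finite_subset[of _ "Pow {..<R}"]) auto

lemma \<J>_finite: "J \<in> \<J> \<Longrightarrow> finite J"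
  unfolding \<J>_def using finite_subset by blast

lemma p_polys: "p \<in> polys n"
  unfolding p_def using r l_polys by (intro polys_prod) force

lemma p_nonzero: "p \<noteq> 0"
  using r l_nonzero by (auto simp: p_def)

lemma prod_homs: "J \<in> \<J> \<Longrightarrow> (\<Prod>i\<in>J. l i) \<in> homs n m"
  using homs_prod[of J l n] \<J>_finite[of J] l_homs by (auto simp: \<J>_def)

lemma L_homs: "J \<in> \<J> \<Longrightarrow> L J \<in> homs n (card (J \<inter> {..<r}))"
  unfolding L_def using r l_homs by (intro homs_prod) auto

lemma L_nonzero: "L J \<noteq> 0"
  using r l_nonzero by (auto simp: L_def)

lemma dvd_prodI:
  assumes "I \<subseteq> {..<r}" "\<And>i. i \<in> I \<Longrightarrow> l i dvd f"
  shows "(\<Prod>i\<in>I. l i) dvd f"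
proof (rule prod_dvdI[where n = n])
  show "finite I" using assms(1) finite_subset by blast
  show "l i \<in> homs n 1 \<and> l i \<noteq> 0" if "i \<in> I" for i
    using that assms(1) r l_homs[of i] l_nonzero[of i] by auto
  show "\<not> l i dvd l j" if "i \<in> I" "j \<in> I" "i \<noteq> j" for i j
    using that assms(1) not_dvd by auto
qed (use assms in auto)

section \<open>The divisibility criterion for operators of the arrangement\<close>

lemma arr_diffops_iff:
  assumes \<delta>: "\<delta> \<in> diffops n m"
  shows "\<delta> \<in> arr_diffops n m p \<longleftrightarrow> (\<forall>J\<in>\<J>. L J dvd diffop_apply n \<delta> (\<Prod>i\<in>J. l i))"
proof -
  let ?E = "diffop_apply n \<delta>"
  obtain m' where m': "m = Suc m'" using m by (cases m) auto
  have E: "diff_order n (Suc m') ?E"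
    using diff_order_diffop_apply[OF \<delta>] by (simp add: m')
  \<comment> \<open>This operator differs from \<open>f \<mapsto> ?E (l i * f)\<close> by a multiple
    of \<open>l i\<close> and has lower order; both directions work with it.\<close>
  have comm: "diff_order n m' (\<lambda>f. ?E (l i * f) - l i * ?E f)" if "i < R" for i
    using diff_order_commutator[OF E l_homs[OF that]] .
  have iff: "\<delta> \<in> arr_diffops n m p \<longleftrightarrow> (\<forall>q\<in>polys n. p dvd ?E (q * p))"
  proof -
    have "\<delta> \<in> arr_diffops n m p \<longleftrightarrow> (\<forall>q\<in>polys n. ?E (q * p) \<in> principal_ideal n p)"
      using \<delta> by (auto simp: arr_diffops_def principal_ideal_def image_subset_iff)
    also have "\<dots> \<longleftrightarrow> (\<forall>q\<in>polys n. p dvd ?E (q * p))"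
      using principal_ideal_iff[OF p_polys p_nonzero] diffop_apply_polys[OF \<delta>] p_polys
      by (auto intro: polys_mult)
    finally show ?thesis .
  qed
  show ?thesis
  proof
    assume "\<delta> \<in> arr_diffops n m p"
    then have *: "p dvd ?E (q * p)" if "q \<in> polys n" for q using that iff by blast
    show "\<forall>J\<in>\<J>. L J dvd ?E (\<Prod>i\<in>J. l i)"
    proof
      fix J assume J: "J \<in> \<J>"
      have "l i dvd ?E (\<Prod>i\<in>J. l i)" if i: "i \<in> J \<inter> {..<r}" for i
      proof -
        have iR: "i < R" using i r by auto
        define P where "P = (\<Prod>j\<in>{..<r} - {i}. l j)"
        have p: "p = l i * P" unfolding p_def P_def using i by (subst prod.remove[of _ i]) auto
        have P: "P \<in> polys n"
          unfolding P_def using r l_polys by (intro polys_prod) force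
        have Q: "(\<Prod>j\<in>J - {i}. l j) \<in> homs n m'"
        proof -
          have "card J = m" using J by (simp add: \<J>_def)
          then have "card (J - {i}) = m'" using i m' by simp
          then show ?thesis
            using homs_prod[of "J - {i}" l n] J \<J>_finite[OF J] l_homs by (auto simp: \<J>_def)
        qed
        \<comment> \<open>The commutator sends multiples of \<open>P\<close> to multiples of
          \<open>l i\<close>, because \<open>?E\<close> maps multiples of \<open>l i * P\<close>
          into the ideal.\<close>
        have "l i dvd P * (?E (l i * (\<Prod>j\<in>J - {i}. l j)) - l i * ?E (\<Prod>j\<in>J - {i}. l j))"
        proof (rule diff_order_dvd_cancel[OF comm[OF iR] P _ Q])
          fix q assume "q \<in> polys n"
          then have "l i dvd ?E (l i * (P * q))"
            using dvd_trans[OF _ *, of "l i" q] by (simp add: p mult_ac)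
          then show "l i dvd ?E (l i * (P * q)) - l i * ?E (P * q)" by (intro dvd_diff) auto
        qed
        moreover have "\<not> l i dvd P"
          unfolding P_def using i l_homs[OF iR] l_nonzero[OF iR] not_dvd
          by (intro linear_form_not_dvd_prod[where n = n]) auto
        ultimately have "l i dvd ?E (l i * (\<Prod>j\<in>J - {i}. l j)) - l i * ?E (\<Prod>j\<in>J - {i}. l j)"
          using linear_form_prime[OF l_homs[OF iR] l_nonzero[OF iR]] by blast
        then have "l i dvd ?E (l i * (\<Prod>j\<in>J - {i}. l j)) - l i * ?E (\<Prod>j\<in>J - {i}. l j)
            + l i * ?E (\<Prod>j\<in>J - {i}. l j)"
          by (intro dvd_add) auto
        moreover have "l i * (\<Prod>j\<in>J - {i}. l j) = (\<Prod>j\<in>J. l j)"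
          using i \<J>_finite[OF J] by (subst prod.remove[of J i]) auto
        ultimately show ?thesis by simp
      qed
      then show "L J dvd ?E (\<Prod>i\<in>J. l i)" unfolding L_def by (intro dvd_prodI) auto
    qed
  next
    assume *: "\<forall>J\<in>\<J>. L J dvd ?E (\<Prod>i\<in>J. l i)"
    have "l i dvd ?E (l i * q)" if i: "i < r" and q: "q \<in> polys n" for i q
    proof -
      have iR: "i < R" using i r by auto
      note lin = diff_order_linear[OF E]
      \<comment> \<open>Without \<open>l i\<close> there remain \<open>m' + n - 1\<close> forms,
        enough to span degree \<open>m'\<close>; a product of \<open>m'\<close> of them times
        \<open>l i\<close> is a product over a set in \<open>\<J>\<close> containing
        \<open>i\<close>.\<close>
      have base: "l i dvd ?E (l i * f)" if f: "f \<in> homs n m'" for f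
      proof (rule generic_products_span[OF gen n _ _ f, of "{..<R} - {i}"])
        show "Suc (card ({..<R} - {i})) = m' + n" using iR R m' by simp
        fix J assume J: "J \<subseteq> {..<R} - {i}" "card J = m'"
        have "finite J" "i \<notin> J" using J finite_subset by auto
        then have iJ: "insert i J \<in> \<J>" unfolding \<J>_def using J iR m' by auto
        have "l i dvd L (insert i J)" unfolding L_def using i \<open>finite J\<close> by (intro dvd_prod_eqI[of _ i]) auto
        then show "l i dvd ?E (l i * (\<Prod>i\<in>J. l i))"
          using * iJ \<open>finite J\<close> \<open>i \<notin> J\<close> by (metis dvd_trans prod.insert)
      qed (auto simp: distrib_left mult.left_commute[of _ "Co _"] lin)
      \<comment> \<open>The commutator has order \<open>m'\<close>, so divisibility on degree
        \<open>m'\<close> carries over to every \<open>q\<close>.\<close>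
      have "l i dvd ?E (l i * q) - l i * ?E q"
        by (rule diff_order_dvd[OF comm[OF iR] _ q]) (intro dvd_diff base dvd_triv_left)
      then have "l i dvd ?E (l i * q) - l i * ?E q + l i * ?E q" by (intro dvd_add) auto
      then show ?thesis by simp
    qed
    note ** = this
    have "p dvd ?E (q * p)" if q: "q \<in> polys n" for q
      unfolding p_def
    proof (rule dvd_prodI)
      fix i assume i: "i \<in> {..<r}"
      define P where "P = (\<Prod>j\<in>{..<r} - {i}. l j)"
      have p: "p = l i * P" unfolding p_def P_def using i by (subst prod.remove[of _ i]) auto
      have P: "P \<in> polys n"
        unfolding P_def using r l_polys by (intro polys_prod) force
      then show "l i dvd ?E (q * (\<Prod>i<r. l i))"
        using **[of i "q * P"] q i by (auto simp: p[unfolded p_def] mult.left_commute intro: polys_mult)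
    qed simp
    then show "\<delta> \<in> arr_diffops n m p" using iff by blast
  qed
qed

section \<open>Operators described by their values on the products\<close>

lemma products_span:
  assumes "f \<in> homs n m" "\<And>f g. P f \<Longrightarrow> P g \<Longrightarrow> P (f + g)" "\<And>c f. P f \<Longrightarrow> P (Co c * f)"
    and "\<And>J. J \<in> \<J> \<Longrightarrow> P (\<Prod>i\<in>J. l i)"
  shows "P f"
proof (rule generic_products_span[OF gen n _ _ assms(1), of "{..<R}"])
  show "P (prod l J)" if "J \<subseteq> {..<R}" "card J = m" for J
    using that assms(4) by (auto simp: \<J>_def)
qed (use assms R in auto)

text \<open>The products span degree \<open>m\<close>, and the monomials of that degree expose the
  coefficients.\<close>

lemma diffop_eqI:
  assumes \<delta>: "\<delta> \<in> diffops n m" "\<epsilon> \<in> diffops n m"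
    and eq: "\<And>J. J \<in> \<J> \<Longrightarrow> diffop_apply n \<delta> (\<Prod>i\<in>J. l i) = diffop_apply n \<epsilon> (\<Prod>i\<in>J. l i)"
  shows "\<delta> = \<epsilon>"
proof (rule poly_mapping_eqI)
  fix \<alpha>
  note lin = diff_order_linear[OF diff_order_diffop_apply[OF \<delta>(1)]]
    diff_order_linear[OF diff_order_diffop_apply[OF \<delta>(2)]]
  show "Poly_Mapping.lookup \<delta> \<alpha> = Poly_Mapping.lookup \<epsilon> \<alpha>"
  proof (cases "\<alpha> \<in> expos n \<and> expo_deg \<alpha> = m")
    case True
    have "diffop_apply n \<delta> f = diffop_apply n \<epsilon> f" if "f \<in> homs n m" for f
      using that by (rule products_span) (auto simp: lin eq)
    from this[of "Poly_Mapping.single \<alpha> 1"] show ?thesis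
      using True \<delta> by (simp add: diffop_apply_single)
  next
    case False
    then have "\<alpha> \<notin> Poly_Mapping.keys \<delta>" "\<alpha> \<notin> Poly_Mapping.keys \<epsilon>"
      using \<delta> unfolding diffops_def by blast+
    then show ?thesis by (simp add: in_keys_iff)
  qed
qed

text \<open>Both sides say that \<delta> maps \<open>homs n m\<close> into \<open>homs n v\<close>:
  the left one tested on monomials, the right one on products.\<close>

lemma diffop_homogeneous_iff:
  assumes \<delta>: "\<delta> \<in> diffops n m"
  shows "diffop_homogeneous v \<delta> \<longleftrightarrow> (\<forall>J\<in>\<J>. diffop_apply n \<delta> (\<Prod>i\<in>J. l i) \<in> homs n v)"
proof -
  note lin = diff_order_linear[OF diff_order_diffop_apply[OF \<delta>]]
  have keys: "\<alpha> \<in> expos n" "expo_deg \<alpha> = m" if "\<alpha> \<in> Poly_Mapping.keys \<delta>" for \<alpha>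
    using \<delta> that by (auto simp: diffops_def)
  have polys: "Poly_Mapping.lookup \<delta> \<alpha> \<in> polys n" for \<alpha> using \<delta> by (auto simp: diffops_def)
  show ?thesis
  proof
    assume hom: "diffop_homogeneous v \<delta>"
    have c: "Poly_Mapping.lookup \<delta> \<beta> \<in> homs n v" for \<beta>
    proof (cases "\<beta> \<in> Poly_Mapping.keys \<delta>")
      case True
      then show ?thesis using hom polys by (auto simp: diffop_homogeneous_def homs_def)
    qed (simp add: in_keys_iff)
    have "diffop_apply n \<delta> f \<in> homs n v" if "f \<in> homs n m" for f
    proof (rule poly_mapping_single_induct[of _ f])
      fix \<beta> c assume "\<beta> \<in> Poly_Mapping.keys f"
      then have "\<beta> \<in> expos n" "expo_deg \<beta> = m" using that by (auto simp: homs_iff)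
      then show "diffop_apply n \<delta> (Poly_Mapping.single \<beta> c) \<in> homs n v"
        using \<delta> c by (simp add: diffop_apply_single homs_Co_mult)
    qed (auto simp: lin intro: homs_add)
    then show "\<forall>J\<in>\<J>. diffop_apply n \<delta> (\<Prod>i\<in>J. l i) \<in> homs n v" using prod_homs by blast
  next
    assume *: "\<forall>J\<in>\<J>. diffop_apply n \<delta> (\<Prod>i\<in>J. l i) \<in> homs n v"
    have **: "diffop_apply n \<delta> f \<in> homs n v" if "f \<in> homs n m" for f
      using that by (rule products_span) (use * in \<open>auto simp: lin intro: homs_add homs_Co_mult\<close>)
    have "homogeneous v (Poly_Mapping.lookup \<delta> \<alpha>)" if "\<alpha> \<in> Poly_Mapping.keys \<delta>" for \<alpha>
    proof -
      \<comment> \<open>Dividing the monomial by its factorial makes the value equal to the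
        coefficient itself.\<close>
      have "Poly_Mapping.lookup \<delta> \<alpha> \<in> homs n v"
        using **[of "Poly_Mapping.single \<alpha> (inverse (efact n \<alpha>))"] keys[OF that]
        by (simp add: diffop_apply_single[OF \<delta>])
      then show ?thesis by (simp add: homs_def)
    qed
    then show "diffop_homogeneous v \<delta>" by (simp add: diffop_homogeneous_def)
  qed
qed

text \<open>For \<open>J \<in> \<J>\<close> let \<open>v\<close> be a point on the hyperplanes outside \<open>J\<close>. Evaluation at \<open>v\<close>, which on
  polynomials of degree \<open>m\<close> is a constant coefficient operator, kills all products indexed by
  \<open>\<J> - {J}\<close>.\<close>

lemma diffop_interpolation:
  assumes q: "\<And>J. J \<in> \<J> \<Longrightarrow> q J \<in> polys n"
  shows "\<exists>\<delta>\<in>diffops n m. \<forall>J\<in>\<J>. diffop_apply n \<delta> (\<Prod>i\<in>J. l i) = q J"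
proof -
  have "\<exists>v. (\<forall>i\<in>J. poly_eval (l i) v \<noteq> 0) \<and> (\<forall>i\<in>{..<R} - J. poly_eval (l i) v = 0)"
    if J: "J \<in> \<J>" for J
  proof -
    have "card ({..<R} - J) = R - m" using J \<J>_finite[OF J] by (auto simp: \<J>_def card_Diff_subset)
    moreover have "m \<le> R" using R n by simp
    ultimately have "Suc (card ({..<R} - J)) = n" using R by simp
    from generic_forms_dual_point[OF gen _ this] show ?thesis
      using J unfolding \<J>_def by (metis (no_types, lifting) DiffD2 Diff_subset lessThan_iff mem_Collect_eq subsetD DiffI)
  qed
  then obtain v where v: "\<And>J i. J \<in> \<J> \<Longrightarrow> i \<in> J \<Longrightarrow> poly_eval (l i) (v J) \<noteq> 0"
    "\<And>J i. J \<in> \<J> \<Longrightarrow> i < R \<Longrightarrow> i \<notin> J \<Longrightarrow> poly_eval (l i) (v J) = 0"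
    by (metis DiffI lessThan_iff)
  \<comment> \<open>Normalised evaluations: on degree \<open>m\<close> they are the basis dual to
    the products.\<close>
  define e where "e J f = poly_eval f (v J) / poly_eval (\<Prod>i\<in>J. l i) (v J)" for J f
  define M where "M = {\<alpha> \<in> expos n. expo_deg \<alpha> = m}"
  \<comment> \<open>The constant coefficients \<open>e J\<close> of the monomial at
    \<open>\<alpha>\<close>, divided by the factorial of \<open>\<alpha>\<close>, realise
    \<open>e J\<close> on degree \<open>m\<close>; \<open>c\<close> superposes them with weights
    \<open>q J\<close>.\<close>
  define c where "c \<alpha> = (\<Sum>J\<in>\<J>. q J * Co (e J (Poly_Mapping.single \<alpha> 1) / efact n \<alpha>))" for \<alpha>
  define \<delta> :: diffop where "\<delta> = (\<Sum>\<alpha>\<in>M. Poly_Mapping.single \<alpha> (c \<alpha>))"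
  have finM: "finite M" unfolding M_def by (rule finite_expos_deg)
  have lookup: "Poly_Mapping.lookup \<delta> \<alpha> = (if \<alpha> \<in> M then c \<alpha> else 0)" for \<alpha>
    using finM by (simp add: \<delta>_def lookup_sum lookup_single when_def)
  have "c \<alpha> \<in> polys n" for \<alpha>
    unfolding c_def using q by (intro polys_sum polys_mult) auto
  then have \<delta>: "\<delta> \<in> diffops n m"
    by (auto simp: diffops_def lookup in_keys_iff M_def split: if_splits)
  note lin = diff_order_linear[OF diff_order_diffop_apply[OF \<delta>]]
  have apply_eq: "diffop_apply n \<delta> f = (\<Sum>J\<in>\<J>. q J * Co (e J f))" if f: "f \<in> homs n m" for f
  proof (rule poly_mapping_single_induct[of _ f])
    show "diffop_apply n \<delta> 0 = (\<Sum>J\<in>\<J>. q J * Co (e J 0))"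
      by (simp add: lin e_def poly_eval_psub)
  next
    fix f g assume "diffop_apply n \<delta> f = (\<Sum>J\<in>\<J>. q J * Co (e J f))"
      "diffop_apply n \<delta> g = (\<Sum>J\<in>\<J>. q J * Co (e J g))"
    moreover have "e J (f + g) = e J f + e J g" for J
      by (simp add: e_def poly_eval_psub eval.psub_add add_divide_distrib)
    ultimately show "diffop_apply n \<delta> (f + g) = (\<Sum>J\<in>\<J>. q J * Co (e J (f + g)))"
      by (simp add: lin single_add distrib_left sum.distrib)
  next
    fix \<beta> a assume "\<beta> \<in> Poly_Mapping.keys f"
    then have \<beta>: "\<beta> \<in> expos n" "expo_deg \<beta> = m" "\<beta> \<in> M" using f by (auto simp: homs_iff M_def)
    have "e J (Poly_Mapping.single \<beta> a) = a * e J (Poly_Mapping.single \<beta> 1)" for J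
      by (simp add: e_def poly_eval_psub eval.psub_single)
    then have summand: "Co (efact n \<beta> * a) * (q J * Co (e J (Poly_Mapping.single \<beta> 1) / efact n \<beta>)) =
        q J * Co (e J (Poly_Mapping.single \<beta> a))" for J
      by (simp add: mult.left_commute[of _ "q J"])
    show "diffop_apply n \<delta> (Poly_Mapping.single \<beta> a) =
        (\<Sum>J\<in>\<J>. q J * Co (e J (Poly_Mapping.single \<beta> a)))"
      unfolding diffop_apply_single[OF \<delta> \<beta>(1,2)] lookup c_def
      using \<beta>(3) by (simp only: if_True sum_distrib_left summand)
  qed
  have "diffop_apply n \<delta> (\<Prod>i\<in>J. l i) = q J" if J: "J \<in> \<J>" for J
  proof -
    have e: "e K (\<Prod>i\<in>J. l i) = (if K = J then 1 else 0)" if K: "K \<in> \<J>" for K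
    proof (cases "K = J")
      case True
      then show ?thesis using v(1)[OF J] \<J>_finite[OF J] by (simp add: e_def poly_eval_prod)
    next
      case False
      \<comment> \<open>Sets of equal size: distinctness yields a factor of the product over
        \<open>J\<close> that vanishes at \<open>v K\<close>.\<close>
      have "\<not> J \<subseteq> K" using False J K \<J>_finite[OF K] card_subset_eq[of K J] by (auto simp: \<J>_def)
      then obtain i where i: "i \<in> J" "i \<notin> K" by auto
      then have "poly_eval (l i) (v K) = 0" using v(2)[OF K] J by (auto simp: \<J>_def)
      then have "poly_eval (\<Prod>i\<in>J. l i) (v K) = 0"
        using i \<J>_finite[OF J] by (auto simp: poly_eval_prod)
      then show ?thesis using False by (simp add: e_def)
    qed
    have "(\<Sum>K\<in>\<J>. q K * Co (e K (\<Prod>i\<in>J. l i))) = (\<Sum>K\<in>\<J>. if K = J then q J else 0)"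
      by (intro sum.cong) (auto simp: e)
    then show ?thesis using J finite_\<J> apply_eq[OF prod_homs[OF J]] by simp
  qed
  then show ?thesis using \<delta> by blast
qed

text \<open>A basis consists of the operators with value \<open>L J\<close> times a monomial at one
  product and 0 at the others. The degree condition is additive, so it has no solution if
  \<open>L J\<close> has degree above \<open>v\<close>.\<close>

lemma dim_graded_piece:
  "op.dim {\<delta> \<in> arr_diffops n m p. diffop_homogeneous v \<delta>} =
    (\<Sum>J\<in>\<J>. card {\<beta> \<in> expos n. expo_deg \<beta> + card (J \<inter> {..<r}) = v})"
proof -
  define M where "M J = {\<beta> \<in> expos n. expo_deg \<beta> + card (J \<inter> {..<r}) = v}" for J
  define I where "I = Sigma \<J> M"
  let ?V = "{\<delta> \<in> arr_diffops n m p. diffop_homogeneous v \<delta>}"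
  have finM: "finite (M J)" for J
    unfolding M_def by (rule finite_subset[OF _ finite_expos_deg[of n "v - card (J \<inter> {..<r})"]]) auto
  have finI: "finite I" unfolding I_def using finite_\<J> finM by simp
  define q where "q i J = (if J = fst i then L J * Poly_Mapping.single (snd i) 1 else 0)"
    for i :: "nat set \<times> expo" and J
  have q_homs: "q i J \<in> homs n v" if "i \<in> I" "J \<in> \<J>" for i J
    using that homs_mult[OF L_homs, of J "Poly_Mapping.single (snd i) 1" "expo_deg (snd i)"]
    by (auto simp: q_def I_def M_def add.commute)
  have "\<exists>\<delta>\<in>diffops n m. \<forall>J\<in>\<J>. diffop_apply n \<delta> (\<Prod>i\<in>J. l i) = q i J" if "i \<in> I" for i
    using q_homs[OF that] by (intro diffop_interpolation) (auto intro: homs_polys)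
  then obtain g where g: "\<And>i. i \<in> I \<Longrightarrow> g i \<in> diffops n m"
    "\<And>i J. i \<in> I \<Longrightarrow> J \<in> \<J> \<Longrightarrow> diffop_apply n (g i) (\<Prod>i\<in>J. l i) = q i J"
    by metis
  have comb: "diffop_apply n (\<Sum>i\<in>I. diffop_scale (t i) (g i)) (\<Prod>i\<in>J. l i) =
      L J * (\<Sum>\<beta>\<in>M J. Poly_Mapping.single \<beta> (t (J, \<beta>)))" if J: "J \<in> \<J>" for t J
  proof -
    have "diffop_apply n (\<Sum>i\<in>I. diffop_scale (t i) (g i)) (\<Prod>i\<in>J. l i) = (\<Sum>i\<in>I. Co (t i) * q i J)"
      using g J by (simp add: diffop_apply_sum_op diffop_apply_scale_op)
    also have "\<dots> = (\<Sum>K\<in>\<J>. \<Sum>\<beta>\<in>M K. Co (t (K, \<beta>)) * q (K, \<beta>) J)"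
      unfolding I_def using finite_\<J> finM by (subst sum.Sigma) auto
    also have "\<dots> = (\<Sum>K\<in>\<J>. if K = J then (\<Sum>\<beta>\<in>M J. L J * Poly_Mapping.single \<beta> (t (J, \<beta>))) else 0)"
      by (intro sum.cong) (auto simp: q_def mult.left_commute[of "Co _"] intro!: sum.cong)
    also have "\<dots> = L J * (\<Sum>\<beta>\<in>M J. Poly_Mapping.single \<beta> (t (J, \<beta>)))"
      using J finite_\<J> by (simp add: sum_distrib_left)
    finally show ?thesis .
  qed
  have "op.dim ?V = card I"
  proof (rule op.dim_eq_card_family[OF finI])
    fix i assume i: "i \<in> I"
    have "L J dvd q i J" for J by (simp add: q_def)
    then show "g i \<in> ?V"
      using g[OF i] q_homs[OF i] by (auto simp: arr_diffops_iff diffop_homogeneous_iff)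
  next
    fix t i assume sum0: "(\<Sum>i\<in>I. diffop_scale (t i) (g i)) = 0" and "i \<in> I"
    then obtain J \<beta> where i: "i = (J, \<beta>)" "J \<in> \<J>" "\<beta> \<in> M J" by (auto simp: I_def)
    have "L J * (\<Sum>\<beta>\<in>M J. Poly_Mapping.single \<beta> (t (J, \<beta>))) = 0"
      using comb[OF i(2), of t] sum0 by simp
    then have "(\<Sum>\<beta>\<in>M J. Poly_Mapping.single \<beta> (t (J, \<beta>))) = 0"
      using L_nonzero by simp
    then have "Poly_Mapping.lookup (\<Sum>\<beta>\<in>M J. Poly_Mapping.single \<beta> (t (J, \<beta>))) \<beta> = 0" by simp
    then show "t i = 0" using i finM by (simp add: lookup_sum lookup_single when_def)
  next
    fix \<delta> assume \<delta>: "\<delta> \<in> ?V"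
    then have \<delta>': "\<delta> \<in> diffops n m" by (auto simp: arr_diffops_def)
    have "\<forall>J\<in>\<J>. \<exists>h. diffop_apply n \<delta> (\<Prod>i\<in>J. l i) = L J * h"
      using \<delta> arr_diffops_iff[OF \<delta>'] by (auto simp: dvd_def)
    then obtain h where h: "\<And>J. J \<in> \<J> \<Longrightarrow> diffop_apply n \<delta> (\<Prod>i\<in>J. l i) = L J * h J" by metis
    \<comment> \<open>The coordinates of \<delta> are the coefficients of the quotients
      \<open>h J\<close>.\<close>
    define t where "t i = Poly_Mapping.lookup (h (fst i)) (snd i)" for i :: "nat set \<times> expo"
    have "\<delta> = (\<Sum>i\<in>I. diffop_scale (t i) (g i))"
    proof (rule diffop_eqI[OF \<delta>'])
      show "(\<Sum>i\<in>I. diffop_scale (t i) (g i)) \<in> diffops n m"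
        using g by (intro diffops_sum diffops_scale)
      fix J assume J: "J \<in> \<J>"
      let ?k = "card (J \<inter> {..<r})"
      have Lh: "L J * h J \<in> homs n v"
        using \<delta> diffop_homogeneous_iff[OF \<delta>'] h[OF J] J by auto
      \<comment> \<open>Only exponents that index basis elements may occur in \<open>h J\<close>; if
        \<open>v\<close> is below the degree of \<open>L J\<close>, the quotient is 0.\<close>
      have "Poly_Mapping.keys (h J) \<subseteq> M J"
      proof (cases "v < ?k")
        case True
        then have "h J = 0"
          using quotient_eq_0_if_degree_less[OF Lh L_homs[OF J] L_nonzero] by simp
        then show ?thesis by simp
      next
        case False
        then have "v = ?k + (v - ?k)" by simp
        then have "h J \<in> homs n (v - ?k)"
          using quotient_in_homs[OF _ L_homs[OF J] L_nonzero, of "h J" "v - ?k"] Lh by metis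
        then show ?thesis using False by (auto simp: homs_iff M_def)
      qed
      note keys = this
      have "(\<Sum>\<beta>\<in>Poly_Mapping.keys (h J). Poly_Mapping.single \<beta> (Poly_Mapping.lookup (h J) \<beta>)) =
          (\<Sum>\<beta>\<in>M J. Poly_Mapping.single \<beta> (Poly_Mapping.lookup (h J) \<beta>))"
      proof (rule sum.mono_neutral_left[OF finM keys], rule ballI)
        fix \<beta> assume "\<beta> \<in> M J - Poly_Mapping.keys (h J)"
        then have "Poly_Mapping.lookup (h J) \<beta> = 0" by (simp add: in_keys_iff)
        then show "Poly_Mapping.single \<beta> (Poly_Mapping.lookup (h J) \<beta>) = 0" by simp
      qed
      with poly_mapping_sum_single[of "h J"]
      have "h J = (\<Sum>\<beta>\<in>M J. Poly_Mapping.single \<beta> (Poly_Mapping.lookup (h J) \<beta>))"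
        by (rule trans)
      then show "diffop_apply n \<delta> (\<Prod>i\<in>J. l i) =
          diffop_apply n (\<Sum>i\<in>I. diffop_scale (t i) (g i)) (\<Prod>i\<in>J. l i)"
        unfolding h[OF J] comb[OF J] t_def fst_conv snd_conv by (rule arg_cong)
    qed
    then show "\<exists>t. \<delta> = (\<Sum>i\<in>I. diffop_scale (t i) (g i))" by blast
  qed
  also have "card I = (\<Sum>J\<in>\<J>. card (M J))"
    unfolding I_def using finite_\<J> finM by simp
  finally show ?thesis unfolding M_def .
qed

end

section \<open>The generating function\<close>

lemma expos_Suc_bij:
  "bij_betw (\<lambda>(k, \<beta>). \<beta> + Poly_Mapping.single n k)
    (SIGMA k:{..d}. {\<beta> \<in> expos n. expo_deg \<beta> = d - k}) {\<beta> \<in> expos (Suc n). expo_deg \<beta> = d}"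
proof (rule bij_betw_byWitness[where f' = "\<lambda>\<beta>. (Poly_Mapping.lookup \<beta> n,
    \<beta> - Poly_Mapping.single n (Poly_Mapping.lookup \<beta> n))"])
  have n: "Poly_Mapping.lookup \<beta> n = 0" if "\<beta> \<in> expos n" for \<beta>
    using that by (auto simp: expos_def in_keys_iff)
  show "\<forall>a\<in>SIGMA k:{..d}. {\<beta> \<in> expos n. expo_deg \<beta> = d - k}.
      (\<lambda>\<beta>. (Poly_Mapping.lookup \<beta> n, \<beta> - Poly_Mapping.single n (Poly_Mapping.lookup \<beta> n)))
        (case a of (k, \<beta>) \<Rightarrow> \<beta> + Poly_Mapping.single n k) = a"
    by (auto simp: lookup_add n)
  have split: "\<beta> - Poly_Mapping.single n (Poly_Mapping.lookup \<beta> n) +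
      Poly_Mapping.single n (Poly_Mapping.lookup \<beta> n) = \<beta>" for \<beta> :: expo
    by (intro poly_mapping_eqI) (auto simp: lookup_add lookup_minus lookup_single when_def)
  then show "\<forall>a'\<in>{\<beta> \<in> expos (Suc n). expo_deg \<beta> = d}.
      (case (Poly_Mapping.lookup a' n, a' - Poly_Mapping.single n (Poly_Mapping.lookup a' n)) of
        (k, \<beta>) \<Rightarrow> \<beta> + Poly_Mapping.single n k) = a'"
    by simp
  show "(\<lambda>(k, \<beta>). \<beta> + Poly_Mapping.single n k) `
      (SIGMA k:{..d}. {\<beta> \<in> expos n. expo_deg \<beta> = d - k}) \<subseteq> {\<beta> \<in> expos (Suc n). expo_deg \<beta> = d}"
  proof (rule image_subsetI)
    fix x assume "x \<in> (SIGMA k:{..d}. {\<beta> \<in> expos n. expo_deg \<beta> = d - k})"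
    then obtain k \<beta> where x: "x = (k, \<beta>)" "k \<le> d" and \<beta>: "\<beta> \<in> expos n" "expo_deg \<beta> = d - k"
      by auto
    have "\<beta> \<in> expos (Suc n)" using \<beta>(1) by (force simp: expos_def)
    then have "\<beta> + Poly_Mapping.single n k \<in> expos (Suc n)" by (simp add: expos_add)
    then show "(case x of (k, \<beta>) \<Rightarrow> \<beta> + Poly_Mapping.single n k) \<in> {\<beta> \<in> expos (Suc n). expo_deg \<beta> = d}"
      using \<beta>(2) x by simp
  qed
  show "(\<lambda>\<beta>. (Poly_Mapping.lookup \<beta> n, \<beta> - Poly_Mapping.single n (Poly_Mapping.lookup \<beta> n))) `
      {\<beta> \<in> expos (Suc n). expo_deg \<beta> = d} \<subseteq> (SIGMA k:{..d}. {\<beta> \<in> expos n. expo_deg \<beta> = d - k})"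
  proof (rule image_subsetI)
    fix \<beta> assume "\<beta> \<in> {\<beta> \<in> expos (Suc n). expo_deg \<beta> = d}"
    then have \<beta>: "\<beta> \<in> expos (Suc n)" "expo_deg \<beta> = d" by auto
    let ?k = "Poly_Mapping.lookup \<beta> n"
    let ?\<gamma> = "\<beta> - Poly_Mapping.single n ?k"
    have "expo_deg \<beta> = expo_deg ?\<gamma> + ?k"
      by (subst split[of \<beta>, symmetric], subst expo_deg_add) simp
    moreover have "?\<gamma> \<in> expos n"
      using \<beta> by (auto simp: expos_def in_keys_iff lookup_minus lookup_single when_def subset_iff less_Suc_eq)
    ultimately show "(?k, ?\<gamma>) \<in> (SIGMA k:{..d}. {\<beta> \<in> expos n. expo_deg \<beta> = d - k})"
      using \<beta>(2) by simp
  qed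
qed

lemma inverse_1_minus_X: "inverse (1 - fps_X :: rat fps) = Abs_fps (\<lambda>_. 1)"
proof (rule fps_inverse_unique)
  show "(1 - fps_X) * Abs_fps (\<lambda>_. 1 :: rat) = 1"
    by (rule fps_ext) (simp add: left_diff_distrib fps_X_mult_nth)
qed

text \<open>Splitting off the exponent of the last variable is convolution with the geometric
  series.\<close>

lemma card_expos_eq_fps_nth:
  "of_nat (card {\<beta> \<in> expos n. expo_deg \<beta> = d}) = fps_nth (inverse (1 - fps_X :: rat fps) ^ n) d"
proof (induction n arbitrary: d)
  case 0
  have "{\<beta> \<in> expos 0. expo_deg \<beta> = d} = (if d = 0 then {0} else {})"
    by (auto simp: expos_def)
  then show ?case by simp
next
  case (Suc n)
  have "card {\<beta> \<in> expos (Suc n). expo_deg \<beta> = d} =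
      card (SIGMA k:{..d}. {\<beta> \<in> expos n. expo_deg \<beta> = d - k})"
    using bij_betw_same_card[OF expos_Suc_bij[of n d]] by simp
  also have "\<dots> = (\<Sum>k\<le>d. card {\<beta> \<in> expos n. expo_deg \<beta> = d - k})"
    by (simp add: finite_expos_deg)
  finally have "of_nat (card {\<beta> \<in> expos (Suc n). expo_deg \<beta> = d}) =
      (\<Sum>k\<le>d. fps_nth (inverse (1 - fps_X :: rat fps) ^ n) (d - k))"
    by (simp add: Suc)
  also have "\<dots> = fps_nth (inverse (1 - fps_X) * inverse (1 - fps_X :: rat fps) ^ n) d"
    by (simp add: fps_mult_nth inverse_1_minus_X atLeast0AtMost)
  finally show ?case by simp
qed

lemma sum_subsets_eq_fps_nth:
  fixes b :: "'a::comm_ring_1"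
  assumes "r \<le> R"
  shows "(\<Sum>J | J \<subseteq> {..<R} \<and> card J = m. b ^ card (J \<inter> {..<r})) =
    fps_nth ((1 + fps_X * fps_const b) ^ r * (1 + fps_X) ^ (R - r)) m"
proof -
  \<comment> \<open>Forms of the arrangement have weight \<open>b\<close>, completing forms weight
    1; expanding the product over all forms then sums over subsets.\<close>
  define c where "c i = (if i < r then b else 1)" for i
  have prod: "(\<Prod>i\<in>J. fps_X * fps_const (c i)) = fps_X ^ card J * fps_const (b ^ card (J \<inter> {..<r}))"
    if "J \<subseteq> {..<R}" for J
  proof -
    have fin: "finite J" using that finite_subset by blast
    then have "(\<Prod>i\<in>J. fps_const (c i)) = fps_const (\<Prod>i\<in>J. c i)"
      by (induction J rule: finite_induct) simp_all
    moreover have "(\<Prod>i\<in>J. c i) = b ^ card (J \<inter> {..<r})"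
      using fin by (simp add: c_def prod.If_cases lessThan_def)
    ultimately show ?thesis by (simp add: prod.distrib)
  qed
  have "(1 + fps_X * fps_const b) ^ r * (1 + fps_X) ^ (R - r) =
      (\<Prod>i<r. 1 + fps_X * fps_const (c i)) * (\<Prod>i\<in>{r..<R}. 1 + fps_X * fps_const (c i))"
    by (simp add: c_def)
  also have "\<dots> = (\<Prod>i<R. fps_X * fps_const (c i) + 1)"
    using assms by (subst prod.union_disjoint[symmetric]) (auto simp: ivl_disj_un add.commute)
  also have "\<dots> = (\<Sum>J\<in>Pow {..<R}. \<Prod>i\<in>J. fps_X * fps_const (c i))"
    by (subst prod_add) simp_all
  also have "\<dots> = (\<Sum>J\<in>Pow {..<R}. fps_X ^ card J * fps_const (b ^ card (J \<inter> {..<r})))"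
    using prod by (intro sum.cong) auto
  finally have "fps_nth ((1 + fps_X * fps_const b) ^ r * (1 + fps_X) ^ (R - r)) m =
      (\<Sum>J\<in>Pow {..<R}. if card J = m then b ^ card (J \<inter> {..<r}) else 0)"
    by (simp add: fps_sum_nth fps_X_power_nth if_distrib if_distribR eq_commute[of m]
        cong: if_cong)
  also have "\<dots> = (\<Sum>J | J \<subseteq> {..<R} \<and> card J = m. b ^ card (J \<inter> {..<r}))"
    by (intro sum.mono_neutral_cong_right) auto
  finally show ?thesis by simp
qed

text \<open>Both coefficients satisfy the recurrence \<open>c\<^sub>r\<^sub>+\<^sub>1\<^sub>,\<^sub>m = c\<^sub>r\<^sub>,\<^sub>m - (1 - b) c\<^sub>r\<^sub>,\<^sub>m\<^sub>-\<^sub>1\<close>.\<close>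

lemma fps_nth_trade_denominator:
  fixes b :: "'a::comm_ring_1" and U :: "'a fps"
  assumes U: "U * (1 - fps_X) = 1" and "r + N + 1 = m + n"
  shows "fps_nth ((1 - fps_X + fps_X * fps_const b) ^ r * U ^ n) m =
    fps_nth ((1 + fps_X * fps_const b) ^ r * (1 + fps_X) ^ N) m"
proof -
  have U0: "fps_nth U 0 = 1" using arg_cong[OF U, of "\<lambda>f. fps_nth f 0"] by simp
  show ?thesis
    using assms(2)
  proof (induction r arbitrary: m N)
    case 0
    have U1: "U ^ Suc k = U ^ k + fps_X * U ^ Suc k" for k
    proof -
      have "U ^ Suc k * (1 - fps_X) = U ^ k * (U * (1 - fps_X))" by (simp only: power_Suc mult_ac)
      then have "U ^ Suc k * (1 - fps_X) = U ^ k" using U by simp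
      then show ?thesis by (simp add: algebra_simps)
    qed
    have nth_U_Suc: "fps_nth (U ^ Suc k) (Suc j) = fps_nth (U ^ k) (Suc j) + fps_nth (U ^ Suc k) j" for k j
      by (subst U1) simp
    have nth_Suc: "fps_nth ((1 + fps_X :: 'a fps) ^ Suc k) (Suc j) =
        fps_nth ((1 + fps_X) ^ k) (Suc j) + fps_nth ((1 + fps_X) ^ k) j" for k j
      by (simp add: distrib_right)
    \<comment> \<open>Both coefficients are the binomial coefficient \<open>N choose m\<close>,
      compared by Pascal's rule.\<close>
    have "fps_nth (U ^ n) m = fps_nth ((1 + fps_X) ^ N) m" if "Suc N = m + n" for N
      using that
    proof (induction n arbitrary: m N)
      case 0
      \<comment> \<open>For \<open>n = 0\<close> the index \<open>m = N + 1\<close> lies just above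
        the degree of the power.\<close>
      have "fps_nth ((1 + fps_X :: 'a fps) ^ k) j = 0" if "k < j" for k j
        using that
      proof (induction k arbitrary: j)
        case (Suc k)
        then obtain j' where "j = Suc j'" by (cases j) auto
        with Suc show ?case by (simp only: nth_Suc) simp
      qed simp
      with 0 show ?case by simp
    next
      case (Suc n)
      from Suc.prems show ?case
      proof (induction m arbitrary: N)
        case 0
        then show ?case using U0 by (simp add: fps_nth_power_0)
      next
        case (Suc m)
        then obtain N' where N: "N = Suc N'" by (cases N) auto
        show ?case
          unfolding N nth_U_Suc nth_Suc
          using Suc.IH[of N'] \<open>\<And>m N. Suc N = m + n \<Longrightarrow> _ m N\<close>[of N' "Suc m"] Suc.prems N by simp
      qed
    qed
    then show ?case using 0 by simp
  next
    case (Suc r)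
    let ?c = "fps_const (1 - b)"
    let ?F = "(1 - fps_X + fps_X * fps_const b) ^ r * U ^ n"
    let ?G = "(1 + fps_X * fps_const b) ^ r * (1 + fps_X) ^ N"
    \<comment> \<open>The factors are \<open>1 - (1 - b) X\<close> and
      \<open>(1 + X) - (1 - b) X\<close>. The second raises \<open>N\<close> by one in the first
      term, so both terms keep the relation \<open>r + N + 1 = m + n\<close>.\<close>
    have F: "(1 - fps_X + fps_X * fps_const b) ^ Suc r * U ^ n = ?F - fps_X * (?c * ?F)"
      by (simp add: algebra_simps flip: fps_const_sub)
    have G: "(1 + fps_X * fps_const b) ^ Suc r * (1 + fps_X) ^ N =
        (1 + fps_X * fps_const b) ^ r * (1 + fps_X) ^ Suc N - fps_X * (?c * ?G)"
      by (simp add: algebra_simps flip: fps_const_sub)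
    show ?case
    proof (cases m)
      case 0
      then show ?thesis using U0 by (simp add: fps_nth_power_0)
    next
      case (Suc m')
      show ?thesis
        unfolding F G Suc using Suc.IH[of "Suc N" m] Suc.IH[of N m'] Suc.prems Suc by simp
    qed
  qed

  qed

lemma fps_geometric_mult: "Abs_fps (\<lambda>_. 1) * (1 - fps_X) = (1 :: 'a::comm_ring_1 fps)"
  by (rule fps_ext) (simp add: right_diff_distrib fps_mult_fps_X_commute[symmetric])

lemma (in generic_setting) hilbert_series_eq:
  "hilbert_series n m p =
    fps_nth ((1 - fps_a + fps_a * fps_b) ^ r / ((1 - fps_a) ^ n * (1 - fps_b) ^ n)) m"
proof -
  define I :: "rat fps" where "I = inverse (1 - fps_X)"
  \<comment> \<open>An explicit inverse of \<open>1 - a\<close>, since the coefficients of series in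
    \<open>a\<close> do not form a field.\<close>
  define U :: "rat fps fps" where "U = Abs_fps (\<lambda>_. 1)"
  define F :: "rat fps fps" where "F = (1 - fps_a + fps_a * fps_b) ^ r"
  have I: "I * (1 - fps_X) = 1" unfolding I_def by (rule inverse_mult_eq_1) simp
  have U: "U * (1 - fps_X) = 1" unfolding U_def by (rule fps_geometric_mult)
  have "hilbert_series n m p = (\<Sum>J\<in>\<J>. fps_X ^ card (J \<inter> {..<r})) * I ^ n"
  proof (rule fps_ext)
    fix v
    have "of_nat (card {\<beta> \<in> expos n. expo_deg \<beta> + k = v}) = fps_nth (fps_X ^ k * I ^ n) v" for k
    proof (cases "k \<le> v")
      case True
      then have "{\<beta> \<in> expos n. expo_deg \<beta> + k = v} = {\<beta> \<in> expos n. expo_deg \<beta> = v - k}" by auto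
      then show ?thesis using True by (simp add: fps_X_power_mult_nth card_expos_eq_fps_nth I_def)
    next
      case False
      then have "{\<beta> \<in> expos n. expo_deg \<beta> + k = v} = {}" by auto
      then show ?thesis using False by (simp add: fps_X_power_mult_nth)
    qed
    then show "fps_nth (hilbert_series n m p) v =
        fps_nth ((\<Sum>J\<in>\<J>. fps_X ^ card (J \<inter> {..<r})) * I ^ n) v"
      by (simp add: hilbert_series_def dim_graded_piece sum_distrib_right fps_sum_nth)
  qed
  also have "(\<Sum>J\<in>\<J>. (fps_X :: rat fps) ^ card (J \<inter> {..<r})) =
      fps_nth ((1 + fps_X * fps_const fps_X) ^ r * (1 + fps_X) ^ (R - r)) m"
    unfolding \<J>_def using r by (rule sum_subsets_eq_fps_nth)
  also have "\<dots> = fps_nth (F * U ^ n) m"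
    unfolding F_def using R r by (intro fps_nth_trade_denominator[OF U, symmetric]) simp
  also have "fps_nth (F * U ^ n) m * I ^ n = fps_nth (F * U ^ n * fps_const I ^ n) m"
    by (simp add: fps_const_power)
  also have "F * U ^ n * fps_const I ^ n = F / ((1 - fps_a) ^ n * (1 - fps_b) ^ n)"
  proof -
    let ?G = "(1 - fps_a) ^ n * (1 - fps_b) ^ n"
    have "fps_const I * (1 - fps_b) = fps_const (I * (1 - fps_X))"
      by (simp add: right_diff_distrib flip: fps_const_mult fps_const_sub)
    moreover have "?G * (U ^ n * fps_const I ^ n) = (U * (1 - fps_a)) ^ n * (fps_const I * (1 - fps_b)) ^ n"
      by (simp only: power_mult_distrib mult_ac)
    ultimately have inv: "?G * (U ^ n * fps_const I ^ n) = 1"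
      using U I by simp
    have div: "F / ?G * ?G = F"
      by (rule fps_fps_divide_mult) (simp add: fps_nth_power_0)
    have "F / ?G = F / ?G * (?G * (U ^ n * fps_const I ^ n))"
      unfolding inv by (rule mult_1_right[symmetric])
    also have "\<dots> = F / ?G * ?G * (U ^ n * fps_const I ^ n)"
      by (rule mult.assoc[symmetric])
    also have "\<dots> = F * U ^ n * fps_const I ^ n"
      unfolding div by (rule mult.assoc[symmetric])
    finally show ?thesis ..
  qed
  finally show ?thesis unfolding F_def .
qed

section \<open>From hyperplane arrangements to families of linear forms\<close>

theorem lemma22:
  fixes m n r :: nat and A :: "point set set" and p :: cpoly
  assumes "m > 0" and "n > 0" and "r > 0"
    and "generic_arrangement n A" and "card A = r"
    and "defining_polynomial n A p"
    and "r \<le> m + n - 1"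
  shows "hilbert_series n m p =
    fps_nth ((1 - fps_a + fps_a * fps_b) ^ r / ((1 - fps_a) ^ n * (1 - fps_b) ^ n)) m"
proof -
  define R where "R = m + n - 1"
  have finA: "finite A" using assms(3,5) card_ge_0_finite by blast
  then obtain h where h: "bij_betw h {..<r} A"
    using ex_bij_betw_nat_finite[of A] assms(5) by (auto simp: atLeast0LessThan)
  obtain lH where lH: "\<And>H. H \<in> A \<Longrightarrow> defines_hyperplane n (lH H) H" and p: "p = (\<Prod>H\<in>A. lH H)"
    using assms(6) unfolding defining_polynomial_def by blast
  define l0 where "l0 i = lH (h i)" for i
  have hA: "h i \<in> A" if "i < r" for i using h that by (auto simp: bij_betw_def)
  have l0: "l0 i \<in> homs n 1" "h i = {v \<in> points n. poly_eval (l0 i) v = 0}" if "i < r" for i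
    using lH[OF hA[OF that]] by (simp_all add: l0_def defines_hyperplane_def linear_form_iff)
  have "generic_forms n l0 r"
    unfolding generic_forms_def
  proof (intro conjI allI impI)
    fix B assume B: "B \<subseteq> {..<r}" "card B \<le> n"
    have "card (h ` B) = card B" using h B by (metis bij_betw_def card_image inj_on_subset)
    moreover have "h ` B \<subseteq> A" using h B by (auto simp: bij_betw_def)
    ultimately have "pt.dim (points n \<inter> \<Inter>(h ` B)) + card B = n"
      using assms(4) B(2) unfolding generic_arrangement_def by metis
    moreover have "points n \<inter> \<Inter>(h ` B) = zeros n l0 B"
      using B(1) l0(2) by (auto simp: zeros_def)
    ultimately show "pt.dim (zeros n l0 B) + card B = n" by simp
  qed (use l0 in simp)
  then obtain l where l: "\<And>i. i < r \<Longrightarrow> l i = l0 i" and gen: "generic_forms n l R"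
    using generic_forms_extend[of n l0 r R] assms(7) by (auto simp: R_def)
  have rR: "r \<le> R" using assms(7) by (simp add: R_def)
  \<comment> \<open>For \<open>n = 1\<close> all completing forms are proportional, so this is
    claimed only inside the arrangement, where the hyperplanes are distinct: divisibility gives
    \<open>h i \<subseteq> h j\<close>, and a proper inclusion would contradict the equal dimensions
    \<open>n - 1\<close>.\<close>
  have not_dvd: "\<not> l i dvd l j" if ij: "i < r" "j < r" "i \<noteq> j" for i j
  proof
    assume "l i dvd l j"
    then obtain q where q: "l j = l i * q" by (elim dvdE)
    have zeros: "zeros n l {k} = h k" if "k < r" for k
      using l0(2)[OF that] l[OF that] by (simp add: zeros_def)
    have dim: "pt.dim (h k) = n - 1" if "k < r" for k
      using generic_formsD(2)[OF gen, of "{k}"] that rR assms(2) zeros[OF that] by simp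
    have li: "l i \<in> homs n 1" "l j \<in> homs n 1" using generic_formsD(1)[OF gen] ij rR by auto
    have sub: "h i \<subseteq> h j" using l0(2) l ij q by (auto simp: poly_eval_mult)
    have "h i \<noteq> h j" using h ij by (auto simp: bij_betw_def inj_on_def)
    then obtain u where u: "u \<in> h j" "u \<notin> h i" using sub by auto
    have "pt.subspace (h j)"
      unfolding zeros[OF ij(2), symmetric] using li by (intro subspace_zeros) auto
    moreover have "h j \<subseteq> points n" using l0(2)[OF ij(2)] by auto
    moreover have "poly_eval (l i) u \<noteq> 0" using u l0(2) l ij by auto
    ultimately have "pt.dim (h j) = Suc (pt.dim {v \<in> h j. poly_eval (l i) v = 0})"
      using li u by (intro dim_hyperplane_section[of _ n]) auto
    moreover have "{v \<in> h j. poly_eval (l i) v = 0} = h i"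
      using l0(2) l ij sub by auto
    ultimately show False using dim ij by simp
  qed
  interpret generic_setting n m r R l
    by standard (use assms gen rR not_dvd in \<open>auto simp: R_def\<close>)
  have "p = (\<Prod>i<r. l i)"
    unfolding p using prod.reindex_bij_betw[OF h, of lH] l by (simp add: l0_def)
  then show ?thesis using hilbert_series_eq by (simp add: p_def)
qed

end
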